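(* Let $U\in U(2^n)$ be an unknown unitary to which we have oracle access, and suppose some $C\in\mathcal{C}_n$ satisfies $D(U,C)\le\epsilon<\frac{\sqrt2}{4}$. Then, with success probability at least $1-\delta$, one can learn $C$ up to global phase using $$\mathcal{O}\!\left(\frac{n\log(n/\delta)}{(\frac{\sqrt2}{4}-\epsilon)^2}\right)$$ queries to $U$.
   Context: For $d\times d$ unitaries ($d=2^n$), $D(U_1,U_2)=\frac{1}{\sqrt{2d^2}}\|U_1\otimes U_1^*-U_2\otimes U_2^*\|_2$ with $\|\cdot\|_2$ the Frobenius norm; equivalently $D(U_1,U_2)=\sqrt{1-\frac{1}{d^2}|\mathrm{Tr}[U_1U_2^\dagger]|^2}$. The Pauli group $\mathcal{P}_n$ consists of $i^kP_1\otimes\cdots\otimes P_n$ with $P_j\in\{I,X,Y,Z\}$, and the Clifford group is $\mathcal{C}_n=\{W\in U(2^n): W\mathcal{P}_nW^\dagger\subseteq\mathcal{P}_n\}$. An oracle query is one application of $U$ to an $n$-qubit register within a quantum circuit. *)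

theory Defs
  imports Complex_Main "Jordan_Normal_Form.Matrix"
begin

definition cconj :: "complex mat \<Rightarrow> complex mat" where
  "cconj A = mat (dim_row A) (dim_col A) (\<lambda>(i,j). cnj (A $$ (i,j)))"

definition cadj :: "complex mat \<Rightarrow> complex mat" where
  "cadj A = mat (dim_col A) (dim_row A) (\<lambda>(i,j). cnj (A $$ (j,i)))"

definition unitary :: "nat \<Rightarrow> complex mat \<Rightarrow> bool" where
  "unitary d U \<longleftrightarrow> U \<in> carrier_mat d d \<and> U * cadj U = 1\<^sub>m d"

definition kron :: "complex mat \<Rightarrow> complex mat \<Rightarrow> complex mat" where
  "kron A B = mat (dim_row A * dim_row B) (dim_col A * dim_col B)
     (\<lambda>(i,j). A $$ (i div dim_row B, j div dim_col B) * B $$ (i mod dim_row B, j mod dim_col B))"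

definition frob :: "complex mat \<Rightarrow> real" where
  "frob A = sqrt (\<Sum>i<dim_row A. \<Sum>j<dim_col A. (cmod (A $$ (i,j)))\<^sup>2)"

definition Dist :: "complex mat \<Rightarrow> complex mat \<Rightarrow> real" where
  "Dist U1 U2 = frob (kron U1 (cconj U1) - kron U2 (cconj U2)) / sqrt (2 * (real (dim_row U1))\<^sup>2)"

definition pauli :: "nat \<Rightarrow> complex mat" where
  "pauli k = (if k = 1 then mat_of_rows_list 2 [[0,1],[1,0]]
         else if k = 2 then mat_of_rows_list 2 [[0,-\<i>],[\<i>,0]]
         else if k = 3 then mat_of_rows_list 2 [[1,0],[0,-1]]
         else 1\<^sub>m 2)"

definition pauli_string :: "nat list \<Rightarrow> complex mat" where
  "pauli_string ps = foldr (\<lambda>k M. kron (pauli k) M) ps (1\<^sub>m 1)"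

definition pauli_group :: "nat \<Rightarrow> complex mat set" where
  "pauli_group n = {(\<i> ^ k) \<cdot>\<^sub>m pauli_string ps | k ps. length ps = n \<and> set ps \<subseteq> {0..3}}"

definition clifford :: "nat \<Rightarrow> complex mat set" where
  "clifford n = {W. unitary (2^n) W \<and> (\<forall>P \<in> pauli_group n. W * P * cadj W \<in> pauli_group n)}"

(* Quantum query algorithm (after deferring all intermediate measurements):
   work register of n + a qubits, initial state |0...0>, unitary V0, then for each
   V in Vs one oracle query (U applied to the first n qubits) followed by V;
   finally measure in the computational basis and output out x.
   Number of oracle queries = length Vs. *)
definition init_state :: "nat \<Rightarrow> complex mat" where
  "init_state N = mat N 1 (\<lambda>(i,j). if i = 0 then 1 else 0)"

definition final_state ::
  "nat \<Rightarrow> complex mat \<Rightarrow> complex mat \<Rightarrow> complex mat list \<Rightarrow> complex mat" where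
  "final_state a U V0 Vs =
     foldl (\<lambda>\<psi> V. V * (kron U (1\<^sub>m (2^a)) * \<psi>))
        (V0 * init_state (dim_row U * 2^a)) Vs"

definition valid_algorithm :: "nat \<Rightarrow> nat \<Rightarrow> complex mat \<Rightarrow> complex mat list \<Rightarrow> bool" where
  "valid_algorithm n a V0 Vs \<longleftrightarrow> (\<forall>V \<in> set (V0 # Vs). unitary (2^(n+a)) V)"

definition equal_up_to_phase :: "complex mat \<Rightarrow> complex mat \<Rightarrow> bool" where
  "equal_up_to_phase W C \<longleftrightarrow> (\<exists>\<theta>::real. W = exp (\<i> * of_real \<theta>) \<cdot>\<^sub>m C)"

definition success_prob ::
  "nat \<Rightarrow> nat \<Rightarrow> complex mat \<Rightarrow> complex mat list \<Rightarrow> (nat \<Rightarrow> complex mat) \<Rightarrow> complex mat \<Rightarrow> complex mat \<Rightarrow> real" where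
  "success_prob n a V0 Vs out U C =
     (\<Sum>x<2^(n+a). if equal_up_to_phase (out x) C
                      then (cmod (final_state a U V0 Vs $$ (x,0)))\<^sup>2 else 0)"

end

theory Submission
  imports Defs "Jordan_Normal_Form.Determinant"
begin

text \<open>Only \<open>U\<close> itself may be queried, so \<open>U P U\<^sup>\<dagger>\<close> cannot be prepared. Instead all queries are spent, in
  parallel, on copies of the Choi state of \<open>U\<close>. Bell measurements on pairs of copies estimate the squares
  of all the correlations \<open>T(P,Q) = tr (U\<^sup>\<dagger> P U Q) / 2\<^sup>n\<close> at once, since the observables
  \<open>(P \<otimes> Q\<^sup>T) \<otimes> (P \<otimes> Q\<^sup>T)\<close> commute. The hypothesis makes the overlap of \<open>U\<close> with \<open>C\<close> at least \<open>7/8\<close>; hence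
  \<open>T(P,Q)\<^sup>2 \<ge> 9/16\<close> if \<open>P = \<plusminus> C Q C\<^sup>\<dagger>\<close>, and otherwise \<open>T(P,Q)\<^sup>2 \<le> 7/16\<close> because some observable of the first
  kind anticommutes with this one. By a Chernoff and a union bound over \<open>16\<^sup>n\<close> pairs, \<open>O(n + log (1/\<delta>))\<close>
  copies determine \<open>C\<close> up to a Pauli factor. Measuring further copies in the basis \<open>C' R\<close>, \<open>R\<close> a Pauli string,
  finds this factor by majority vote. When \<open>n = 1\<close> and \<open>\<delta>\<close> is close to \<open>1\<close> the bound may allow no query
  at all; then a uniform guess among finitely many candidates is good enough.\<close>

section \<open>Matrices\<close>

text \<open>The thresholds come from geometry. Splitting \<open>U\<close> into a multiple of
  \<open>C\<close> and an orthogonal remainder gives a correlation of at least 2 * 7/8 - 1 = 3/4 for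
  observables that stabilize \<open>C\<close>; two anticommuting observables have squared
  correlations of sum at most 1, so 9/16 for one forces 7/16 for the other. This gap stays open
  however close \<epsilon> is to its limit, so the learner does not depend on \<epsilon>, and the
  denominator of the bound, being at most 1, only loosens it. Squaring loses the sign of a
  correlation; this is the reason why a Pauli factor is left over after the first stage. The circuit
  model shapes the rest. The oracle acts on the first \<open>n\<close> qubits only, so registers are
  rotated past it. Measurements come last, so a basis that depends on an earlier outcome becomes a
  block-controlled unitary. No probability space is set up: a possible failure is replaced by a
  nonnegative weight that is at least 1 on it, and the expectation of such a weight is a finite sum
  of products over the digits of the outcome.\<close>

lemma mult_entry:
  fixes A B :: "complex mat"
  assumes "A \<in> carrier_mat r k" "B \<in> carrier_mat k c" "i < r" "j < c"
  shows "(A * B) $$ (i,j) = (\<Sum>l<k. A $$ (i,l) * B $$ (l,j))"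
  using assms by (auto simp: scalar_prod_def lessThan_atLeast0 intro!: sum.cong)

lemma dim_cadj [simp]: "dim_row (cadj A) = dim_col A" "dim_col (cadj A) = dim_row A"
  by (simp_all add: cadj_def)

text \<open>Premises on dimensions instead of carriers can be discharged by \<open>simp\<close>
  inside nested products; the \<open>_dim\<close> rules and the scalar rules further on have the
  same form.\<close>

lemma mat_assoc:
  fixes A B C :: "complex mat"
  shows "dim_col A = dim_row B \<Longrightarrow> dim_col B = dim_row C \<Longrightarrow> (A * B) * C = A * (B * C)"
  by (rule assoc_mult_mat) auto

lemma cadj_carrier [simp, intro]: "A \<in> carrier_mat r c \<Longrightarrow> cadj A \<in> carrier_mat c r"
  by (auto simp: cadj_def)

lemma cadj_entry: "A \<in> carrier_mat r c \<Longrightarrow> i < c \<Longrightarrow> j < r \<Longrightarrow> cadj A $$ (i,j) = cnj (A $$ (j,i))"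
  by (auto simp: cadj_def)

lemma cadj_cadj [simp]: "cadj (cadj A) = A"
  by (rule eq_matI) (auto simp: cadj_def)

lemma cadj_one [simp]: "cadj (1\<^sub>m n) = 1\<^sub>m n"
  by (rule eq_matI) (auto simp: cadj_def)

lemma cadj_smult: "cadj (c \<cdot>\<^sub>m A) = cnj c \<cdot>\<^sub>m cadj A"
  by (rule eq_matI) (auto simp: cadj_def)

lemma cadj_mult:
  assumes A: "A \<in> carrier_mat r k" and B: "B \<in> carrier_mat k c"
  shows "cadj (A * B) = cadj B * cadj A"
proof (rule eq_matI)
  fix i j assume "i < dim_row (cadj B * cadj A)" "j < dim_col (cadj B * cadj A)"
  then have ij: "i < c" "j < r" using A B by (auto simp: cadj_def)
  have "cadj (A * B) $$ (i,j) = (\<Sum>l<k. cnj (A $$ (j,l)) * cnj (B $$ (l,i)))"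
    using ij mult_carrier_mat[OF A B] by (simp add: cadj_entry[of _ r c] mult_entry[OF A B] del: index_mult_mat)
  also have "\<dots> = (cadj B * cadj A) $$ (i,j)"
    using ij A B by (subst mult_entry[of _ c k _ r])
      (auto simp: cadj_entry[OF A] cadj_entry[OF B] mult.commute intro!: sum.cong)
  finally show "cadj (A * B) $$ (i,j) = (cadj B * cadj A) $$ (i,j)" .
qed (use A B in \<open>auto simp: cadj_def\<close>)

lemma cadj_mult_dim: "dim_col A = dim_row B \<Longrightarrow> cadj (A * B) = cadj B * cadj A"
  by (rule cadj_mult) auto

lemma transpose_mult_dim:
  fixes A B :: "complex mat"
  shows "dim_col A = dim_row B \<Longrightarrow> transpose_mat (A * B) = transpose_mat B * transpose_mat A"
  by (rule transpose_mult) auto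

lemma unitary_carrier: "unitary d U \<Longrightarrow> U \<in> carrier_mat d d"
  by (simp add: unitary_def)

text \<open>\<open>unitary\<close> demands a right inverse; for square matrices it is also a left
  inverse.\<close>

lemma unitary_left: "unitary d U \<Longrightarrow> cadj U * U = 1\<^sub>m d"
  unfolding unitary_def using mat_mult_left_right_inverse[of U d "cadj U"] by auto

lemma unitary_right: "unitary d U \<Longrightarrow> U * cadj U = 1\<^sub>m d"
  by (simp add: unitary_def)

lemma unitary_cadj: "unitary d U \<Longrightarrow> unitary d (cadj U)"
  using unitary_left[of d U] by (auto simp: unitary_def)

lemma unitary_one [simp]: "unitary d (1\<^sub>m d)"
  by (simp add: unitary_def)

lemma unitary_mult:
  assumes U: "unitary d U" and V: "unitary d V"
  shows "unitary d (U * V)"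
proof -
  note c = unitary_carrier[OF U] unitary_carrier[OF V]
  have "(U * V) * cadj (U * V) = U * (V * cadj V) * cadj U"
    unfolding cadj_mult[OF c]
    using c by (simp add: mat_assoc)
  also have "\<dots> = 1\<^sub>m d" using c unitary_right[OF U] unitary_right[OF V] by simp
  finally show ?thesis using c by (simp add: unitary_def)
qed

text \<open>Orthonormality of the rows, the criterion by which unitaries given through their entries
  are verified.\<close>

lemma unitaryI:
  assumes A: "A \<in> carrier_mat d d"
    and "\<And>i j. i < d \<Longrightarrow> j < d \<Longrightarrow> (\<Sum>k<d. A $$ (i,k) * cnj (A $$ (j,k))) = (if i = j then 1 else 0)"
  shows "unitary d A"
  unfolding unitary_def
proof (intro conjI A eq_matI)
  fix i j assume "i < dim_row (1\<^sub>m d :: complex mat)" "j < dim_col (1\<^sub>m d :: complex mat)"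
  then have ij: "i < d" "j < d" by auto
  have "(A * cadj A) $$ (i,j) = (\<Sum>k<d. A $$ (i,k) * cnj (A $$ (j,k)))"
    using ij A by (subst mult_entry[of _ d d _ d]) (auto simp: cadj_entry[OF A])
  then show "(A * cadj A) $$ (i,j) = 1\<^sub>m d $$ (i,j)"
    using ij assms(2) by simp
qed (use A in \<open>auto simp: cadj_def\<close>)

lemma unitaryD:
  assumes U: "unitary d A" and ij: "i < d" "j < d"
  shows "(\<Sum>k<d. A $$ (i,k) * cnj (A $$ (j,k))) = (if i = j then 1 else 0)"
proof -
  note A = unitary_carrier[OF U]
  have "(A * cadj A) $$ (i,j) = (\<Sum>k<d. A $$ (i,k) * cnj (A $$ (j,k)))"
    using ij A by (subst mult_entry[of _ d d _ d]) (auto simp: cadj_entry[OF A])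
  then show ?thesis using unitary_right[OF U] ij by simp
qed

lemma sum_lessThan_mult:
  fixes f :: "nat \<Rightarrow> 'a::comm_monoid_add"
  shows "(\<Sum>x<a*b. f x) = (\<Sum>i<a. \<Sum>j<b. f (i*b+j))"
proof -
  have *: "sum f {i*b..<i*b+b} = (\<Sum>j<b. f (i*b+j))" for i
    using sum.shift_bounds_nat_ivl[of f 0 "i*b" b]
    by (simp add: lessThan_atLeast0 add.commute)
  show ?thesis using sum.nat_group[of f b a] by (simp add: *)
qed

lemma add_lt_mult: "i < a \<Longrightarrow> j < b \<Longrightarrow> i * b + j < a * (b::nat)"
proof -
  assume "i < a" "j < b"
  then have "i * b + j < (i+1) * b" by simp
  also have "\<dots> \<le> a * b" using \<open>i < a\<close> by (intro mult_le_mono) auto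
  finally show ?thesis .
qed

lemma div_lt_mult: "x < a * b \<Longrightarrow> x div b < (a::nat)"
  by (simp add: less_mult_imp_div_less)

lemma mod_lt_mult: "x < a * b \<Longrightarrow> x mod b < (b::nat)"
  by (cases b) auto

lemma divmod_eq_iff: "x = y \<longleftrightarrow> x div b = y div b \<and> x mod b = y mod (b::nat)"
  by (metis div_mult_mod_eq)

section \<open>Kronecker products, with indices read as two-digit numbers\<close>

lemma kron_carrier [simp, intro]:
  "A \<in> carrier_mat a b \<Longrightarrow> B \<in> carrier_mat c e \<Longrightarrow> kron A B \<in> carrier_mat (a*c) (b*e)"
  by (auto simp: kron_def)

lemma kron_entry:
  "A \<in> carrier_mat a b \<Longrightarrow> B \<in> carrier_mat c e \<Longrightarrow> x < a*c \<Longrightarrow> y < b*e \<Longrightarrow>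
   kron A B $$ (x,y) = A $$ (x div c, y div e) * B $$ (x mod c, y mod e)"
  by (auto simp: kron_def)

lemma kron_entry':
  assumes "A \<in> carrier_mat a b" "B \<in> carrier_mat c e" "i < a" "k < c" "j < b" "l < e"
  shows "kron A B $$ (i*c+k, j*e+l) = A $$ (i,j) * B $$ (k,l)"
  using assms by (subst kron_entry[of A a b B c e]) (auto simp: add_lt_mult)

lemma kron_mult:
  assumes A: "A \<in> carrier_mat a b" and B: "B \<in> carrier_mat c e"
    and A': "A' \<in> carrier_mat b a'" and B': "B' \<in> carrier_mat e c'"
  shows "kron A B * kron A' B' = kron (A * A') (B * B')"
proof (rule eq_matI)
  fix x y assume "x < dim_row (kron (A * A') (B * B'))" "y < dim_col (kron (A * A') (B * B'))"
  then have x: "x < a * c" "y < a' * c'" using assms by (auto simp: kron_def)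
  have d: "x div c < a" "y div c' < a'" "x mod c < c" "y mod c' < c'"
    using x by (auto simp: div_lt_mult mod_lt_mult)
  have "(kron A B * kron A' B') $$ (x,y) = (\<Sum>z<b*e. kron A B $$ (x,z) * kron A' B' $$ (z,y))"
    by (rule mult_entry[OF kron_carrier[OF A B] kron_carrier[OF A' B'] x])
  also have "\<dots> = (\<Sum>i<b. \<Sum>j<e. (A $$ (x div c, i) * A' $$ (i, y div c')) * (B $$ (x mod c, j) * B' $$ (j, y mod c')))"
    unfolding sum_lessThan_mult
    using x by (intro sum.cong refl)
      (auto simp: kron_entry[OF A B] kron_entry[OF A' B'] add_lt_mult)
  also have "\<dots> = (A * A') $$ (x div c, y div c') * (B * B') $$ (x mod c, y mod c')"
    by (simp add: mult_entry[OF A A'] mult_entry[OF B B'] d sum_product)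
  also have "\<dots> = kron (A * A') (B * B') $$ (x,y)"
    by (rule kron_entry[symmetric, OF mult_carrier_mat[OF A A'] mult_carrier_mat[OF B B'] x])
  finally show "(kron A B * kron A' B') $$ (x,y) = kron (A * A') (B * B') $$ (x,y)" .
qed (use assms in \<open>auto simp: kron_def\<close>)

text \<open>Both sides read the same three mixed-radix digits off an index, so the equality is
  literal; the facts \<open>e\<close> compare the two orders of extracting the digits.\<close>

lemma kron_assoc:
  "kron (kron A B) C = kron A (kron B C)"
proof (rule eq_matI)
  fix x y assume a: "x < dim_row (kron A (kron B C))" "y < dim_col (kron A (kron B C))"
  then have x: "x < dim_row A * dim_row B * dim_row C" "y < dim_col A * dim_col B * dim_col C"
    by (auto simp: kron_def algebra_simps)
  have lt: "x div dim_row C < dim_row A * dim_row B" "y div dim_col C < dim_col A * dim_col B"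
    using x by (auto intro: div_lt_mult)
  have lt2: "x mod (dim_row B * dim_row C) < dim_row B * dim_row C"
       "y mod (dim_col B * dim_col C) < dim_col B * dim_col C"
    using x by (intro mod_less_divisor; auto intro!: Nat.gr0I)+
  have e: "x mod (p * q) div q = x div q mod p" "x mod (p * q) mod q = x mod q"
      "x div q div p = x div (p * q)" for x p q :: nat
  proof -
    have *: "x mod (p * q) = q * (x div q mod p) + x mod q"
      using mod_mult2_eq[of x q p] by (simp add: mult.commute)
    show "x mod (p * q) div q = x div q mod p" unfolding * by (cases "q = 0") auto
    show "x mod (p * q) mod q = x mod q" unfolding * by simp
    show "x div q div p = x div (p * q)" by (simp add: div_mult2_eq mult.commute[of p])
  qed
  show "kron (kron A B) C $$ (x,y) = kron A (kron B C) $$ (x,y)"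
    using x a lt lt2 by (simp add: kron_def e mult.assoc)
qed (auto simp: kron_def)

lemma kron_one: "kron (1\<^sub>m a) (1\<^sub>m b) = 1\<^sub>m (a*b)"
proof (rule eq_matI)
  fix x y assume "x < dim_row (1\<^sub>m (a*b) :: complex mat)" "y < dim_col (1\<^sub>m (a*b) :: complex mat)"
  then have x: "x < a*b" "y < a*b" by auto
  show "kron (1\<^sub>m a) (1\<^sub>m b) $$ (x,y) = (1\<^sub>m (a*b) :: complex mat) $$ (x,y)"
    using x by (subst kron_entry[of _ a a _ b b])
      (use divmod_eq_iff[of x y b] in \<open>auto simp: div_lt_mult mod_lt_mult\<close>)
qed (auto simp: kron_def)

lemma kron_one_left [simp]: "kron (1\<^sub>m (Suc 0)) A = A"
  by (rule eq_matI) (auto simp: kron_def)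

lemma kron_one_right [simp]: "kron A (1\<^sub>m (Suc 0)) = A"
  by (rule eq_matI) (auto simp: kron_def)

lemma cadj_kron: "cadj (kron A B) = kron (cadj A) (cadj B)"
proof (rule eq_matI)
  fix x y assume "x < dim_row (kron (cadj A) (cadj B))" "y < dim_col (kron (cadj A) (cadj B))"
  then have "x < dim_col A * dim_col B" "y < dim_row A * dim_row B" by (auto simp: kron_def cadj_def)
  then show "cadj (kron A B) $$ (x,y) = kron (cadj A) (cadj B) $$ (x,y)"
    by (simp add: cadj_def kron_def div_lt_mult mod_lt_mult)
qed (auto simp: kron_def cadj_def)

lemma transpose_kron: "transpose_mat (kron A B) = kron (transpose_mat A) (transpose_mat B)"
proof (rule eq_matI)
  fix x y assume "x < dim_row (kron (transpose_mat A) (transpose_mat B))" "y < dim_col (kron (transpose_mat A) (transpose_mat B))"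
  then have "x < dim_col A * dim_col B" "y < dim_row A * dim_row B" by (auto simp: kron_def)
  then show "transpose_mat (kron A B) $$ (x,y) = kron (transpose_mat A) (transpose_mat B) $$ (x,y)"
    by (simp add: kron_def div_lt_mult mod_lt_mult)
qed (auto simp: kron_def)

lemma kron_smult: "kron (a \<cdot>\<^sub>m A) (b \<cdot>\<^sub>m B) = (a * b) \<cdot>\<^sub>m kron A B"
proof (rule eq_matI)
  fix x y assume "x < dim_row ((a * b) \<cdot>\<^sub>m kron A B)" "y < dim_col ((a * b) \<cdot>\<^sub>m kron A B)"
  then have "x < dim_row A * dim_row B" "y < dim_col A * dim_col B" by (auto simp: kron_def)
  then show "kron (a \<cdot>\<^sub>m A) (b \<cdot>\<^sub>m B) $$ (x,y) = ((a * b) \<cdot>\<^sub>m kron A B) $$ (x,y)"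
    by (simp add: kron_def div_lt_mult mod_lt_mult)
qed (auto simp: kron_def)

lemma unitary_kron:
  assumes U: "unitary a U" and V: "unitary b V"
  shows "unitary (a*b) (kron U V)"
proof -
  note c = unitary_carrier[OF U] unitary_carrier[OF V]
  have "kron U V * cadj (kron U V) = kron (U * cadj U) (V * cadj V)"
    unfolding cadj_kron using c by (intro kron_mult) auto
  also have "\<dots> = 1\<^sub>m (a*b)" using U V by (simp add: unitary_right kron_one)
  finally show ?thesis using c by (auto simp: unitary_def)
qed

section \<open>Tensor powers and product distributions\<close>

fun mpow :: "complex mat \<Rightarrow> nat \<Rightarrow> complex mat" where
  "mpow A 0 = 1\<^sub>m 1"
| "mpow A (Suc k) = kron A (mpow A k)"

lemma mpow_carrier [simp, intro]: "A \<in> carrier_mat r c \<Longrightarrow> mpow A k \<in> carrier_mat (r^k) (c^k)"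
  by (induction k) auto

lemma mpow_mult:
  assumes "A \<in> carrier_mat r s" "B \<in> carrier_mat s t"
  shows "mpow A k * mpow B k = mpow (A * B) k"
proof (induction k)
  case (Suc k)
  have "mpow A (Suc k) * mpow B (Suc k) = kron (A * B) (mpow A k * mpow B k)"
    using assms by (simp, intro kron_mult) auto
  then show ?case using Suc by simp
qed simp

lemma mpow_add: "kron (mpow A m) (mpow A k) = mpow A (m+k)"
  by (induction m) (simp_all add: kron_assoc)

lemma mpow_Suc_right: "kron (mpow A k) A = mpow A (Suc k)"
  using mpow_add[of A k 1] by simp

lemma mpow_kron_self: "mpow (kron A A) m = mpow A (2*m)"
  by (induction m) (simp_all add: kron_assoc)

lemma unitary_mpow: "unitary d U \<Longrightarrow> unitary (d^k) (mpow U k)"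
  by (induction k) (auto intro: unitary_kron)

text \<open>Product functions on strings of length \<open>m\<close> over an alphabet of size \<open>b\<close>, the string being
  encoded as a number below \<open>b ^ m\<close>.\<close>

fun tpow :: "nat \<Rightarrow> (nat \<Rightarrow> 'a::comm_monoid_mult) \<Rightarrow> nat \<Rightarrow> nat \<Rightarrow> 'a" where
  "tpow b f 0 x = 1"
| "tpow b f (Suc m) x = f (x div b^m) * tpow b f m (x mod b^m)"

text \<open>With probabilities inside \<open>f\<close> this is the expectation of a product over
  \<open>m\<close> independent draws, the factorisation on which the exponential moment bounds
  rest.\<close>

lemma sum_tpow:
  fixes f :: "nat \<Rightarrow> 'a::comm_semiring_1"
  shows "(\<Sum>x<b^m. tpow b f m x) = (\<Sum>i<b. f i)^m"
proof (induction m)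
  case (Suc m)
  have "(\<Sum>x<b^Suc m. tpow b f (Suc m) x) = (\<Sum>i<b. \<Sum>j<b^m. f i * tpow b f m j)"
    unfolding power_Suc sum_lessThan_mult by (intro sum.cong refl) auto
  also have "\<dots> = (\<Sum>i<b. f i) * (\<Sum>j<b^m. tpow b f m j)" by (simp add: sum_product)
  finally show ?case using Suc by simp
qed simp

lemma tpow_mult: "tpow b (\<lambda>i. f i * g i) m x = tpow b f m x * tpow b g m x"
  by (induction m arbitrary: x) (auto simp: algebra_simps)

lemma tpow_mono:
  fixes f g :: "nat \<Rightarrow> real"
  assumes "\<And>i. 0 \<le> f i" "\<And>i. f i \<le> g i"
  shows "0 \<le> tpow b f m x \<and> tpow b f m x \<le> tpow b g m x"
proof (induction m arbitrary: x)
  case (Suc m)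
  have g: "0 \<le> g i" for i using assms[of i] by linarith
  show ?case using Suc[of "x mod b^m"] assms g by (auto intro!: mult_mono mult_nonneg_nonneg)
qed simp

lemma tpow_pos:
  fixes f :: "nat \<Rightarrow> real"
  shows "(\<And>i. 0 < f i) \<Longrightarrow> 0 < tpow b f m x"
  by (induction m arbitrary: x) auto

lemma tpow_const_one: "tpow b (\<lambda>i. 1) m x = 1"
  by (induction m arbitrary: x) auto

lemma mpow_column:
  assumes "v \<in> carrier_mat b 1" "x < b^m"
  shows "mpow v m $$ (x,0) = tpow b (\<lambda>i. v $$ (i,0)) m x"
  using assms(2)
proof (induction m arbitrary: x)
  case (Suc m)
  have c: "mpow v m \<in> carrier_mat (b^m) 1" using mpow_carrier[OF assms(1), of m] by simp
  have x: "x < b * b^m" using Suc.prems by simp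
  have "x mod b^m < b^m" using x by (rule mod_lt_mult)
  then show ?case using Suc.IH[of "x mod b^m"] x
    by (simp add: kron_entry[OF assms(1) c])
qed simp

lemma cmod_tpow: "(cmod (tpow b f m x))\<^sup>2 = tpow b (\<lambda>i. (cmod (f i))\<^sup>2) m x"
  by (induction m arbitrary: x) (auto simp: norm_mult power_mult_distrib)

lemma unitary_norm_column:
  assumes U: "unitary N U" and v: "v \<in> carrier_mat N 1"
  shows "(\<Sum>x<N. (cmod ((U * v) $$ (x,0)))\<^sup>2) = (\<Sum>x<N. (cmod (v $$ (x,0)))\<^sup>2)"
proof -
  have *: "complex_of_real (\<Sum>x<N. (cmod (w $$ (x,0)))\<^sup>2) = (cadj w * w) $$ (0,0)"
    if w: "w \<in> carrier_mat N 1" for w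
    using w by (subst mult_entry[of _ 1 N _ 1]) 
      (auto simp: cadj_entry[OF w] complex_norm_square mult.commute simp del: of_real_power intro!: sum.cong)
  have c: "U \<in> carrier_mat N N" using U by (rule unitary_carrier)
  have "cadj (U * v) * (U * v) = cadj v * (cadj U * U) * v"
    unfolding cadj_mult[OF c v] using c v
    by (simp add: mat_assoc)
  also have "\<dots> = cadj v * v" using v by (simp add: unitary_left[OF U])
  finally have "complex_of_real (\<Sum>x<N. (cmod ((U * v) $$ (x,0)))\<^sup>2) = complex_of_real (\<Sum>x<N. (cmod (v $$ (x,0)))\<^sup>2)"
    using *[OF v] *[of "U * v"] c v by auto
  then show ?thesis by (simp only: of_real_eq_iff)
qed

section \<open>The Hilbert--Schmidt inner product\<close>

text \<open>This is the trace of \<open>cadj A * B\<close>. On \<open>2^n\<close> by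
  \<open>2^n\<close> matrices it equals \<open>2^n\<close> times the inner product of the Choi
  states, so statements about expectations in Choi states become geometry of matrices.\<close>

definition hs :: "complex mat \<Rightarrow> complex mat \<Rightarrow> complex" where
  "hs A B = (\<Sum>i<dim_row A. \<Sum>j<dim_col A. cnj (A $$ (i,j)) * B $$ (i,j))"

lemma hs_alt: "A \<in> carrier_mat r c \<Longrightarrow> hs A B = (\<Sum>i<r. \<Sum>j<c. cnj (A $$ (i,j)) * B $$ (i,j))"
  by (auto simp: hs_def)

lemma hs_left_mult:
  assumes X: "X \<in> carrier_mat r k" and A: "A \<in> carrier_mat k c" and B: "B \<in> carrier_mat r c"
  shows "hs (X * A) B = hs A (cadj X * B)"
proof -
  have "hs (X * A) B = (\<Sum>i<r. \<Sum>j<c. \<Sum>l<k. cnj (X $$ (i,l)) * cnj (A $$ (l,j)) * B $$ (i,j))"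
    using mult_carrier_mat[OF X A]
    by (auto simp: hs_alt[of _ r c] mult_entry[OF X A] sum_distrib_right intro!: sum.cong)
  also have "\<dots> = (\<Sum>i<r. \<Sum>l<k. \<Sum>j<c. cnj (X $$ (i,l)) * cnj (A $$ (l,j)) * B $$ (i,j))"
    by (intro sum.cong refl sum.swap)
  also have "\<dots> = (\<Sum>l<k. \<Sum>i<r. \<Sum>j<c. cnj (X $$ (i,l)) * cnj (A $$ (l,j)) * B $$ (i,j))"
    by (rule sum.swap)
  also have "\<dots> = (\<Sum>l<k. \<Sum>j<c. \<Sum>i<r. cnj (X $$ (i,l)) * cnj (A $$ (l,j)) * B $$ (i,j))"
    by (intro sum.cong refl sum.swap)
  also have "\<dots> = hs A (cadj X * B)"
    by (auto simp: hs_alt[OF A] mult_entry[OF cadj_carrier[OF X] B] cadj_entry[OF X] sum_distrib_left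
        algebra_simps intro!: sum.cong)
  finally show ?thesis .
qed

lemma hs_right_mult:
  assumes A: "A \<in> carrier_mat r k" and X: "X \<in> carrier_mat k c" and B: "B \<in> carrier_mat r c"
  shows "hs (A * X) B = hs A (B * cadj X)"
proof -
  have "hs (A * X) B = (\<Sum>i<r. \<Sum>j<c. \<Sum>l<k. cnj (A $$ (i,l)) * cnj (X $$ (l,j)) * B $$ (i,j))"
    using mult_carrier_mat[OF A X]
    by (auto simp: hs_alt[of _ r c] mult_entry[OF A X] sum_distrib_right intro!: sum.cong)
  also have "\<dots> = (\<Sum>i<r. \<Sum>l<k. \<Sum>j<c. cnj (A $$ (i,l)) * cnj (X $$ (l,j)) * B $$ (i,j))"
    by (intro sum.cong refl sum.swap)
  also have "\<dots> = hs A (B * cadj X)"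
    by (auto simp: hs_alt[OF A] mult_entry[OF B cadj_carrier[OF X]] cadj_entry[OF X] sum_distrib_left
        algebra_simps intro!: sum.cong)
  finally show ?thesis .
qed

lemma hs_cnj: "A \<in> carrier_mat r c \<Longrightarrow> B \<in> carrier_mat r c \<Longrightarrow> cnj (hs A B) = hs B A"
  by (auto simp: hs_alt[of _ r c] mult.commute intro!: sum.cong)

lemma hs_smult_left: "hs (a \<cdot>\<^sub>m A) B = cnj a * hs A B"
  by (auto simp: hs_def sum_distrib_left algebra_simps intro!: sum.cong)

lemma hs_smult_right:
  "A \<in> carrier_mat r c \<Longrightarrow> B \<in> carrier_mat r c \<Longrightarrow> hs A (a \<cdot>\<^sub>m B) = a * hs A B"
  by (auto simp: hs_alt[of _ r c] sum_distrib_left algebra_simps intro!: sum.cong)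

lemma hs_minus_right:
  "A \<in> carrier_mat r c \<Longrightarrow> B \<in> carrier_mat r c \<Longrightarrow> C \<in> carrier_mat r c \<Longrightarrow>
   hs A (B - C) = hs A B - hs A C"
  by (auto simp: hs_alt[of _ r c] right_diff_distrib sum_subtractf)

lemma hs_minus_left:
  "A \<in> carrier_mat r c \<Longrightarrow> B \<in> carrier_mat r c \<Longrightarrow> C \<in> carrier_mat r c \<Longrightarrow>
   hs (A - B) C = hs A C - hs B C"
  by (auto simp: hs_alt[of _ r c] left_diff_distrib sum_subtractf minus_carrier_mat)

lemma hs_self: "hs A A = complex_of_real (\<Sum>i<dim_row A. \<Sum>j<dim_col A. (cmod (A $$ (i,j)))\<^sup>2)"
  unfolding hs_def of_real_sum by (intro sum.cong refl) (simp add: complex_norm_square mult.commute del: of_real_power)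

lemma hs_self_nonneg: "0 \<le> Re (hs A A)"
  unfolding hs_self by (simp add: sum_nonneg)

lemma hs_self_unitary:
  assumes U: "unitary d U" shows "hs U U = of_nat d"
proof -
  note c = unitary_carrier[OF U]
  have "hs U U = (\<Sum>i<d. \<Sum>k<d. U $$ (i,k) * cnj (U $$ (i,k)))"
    unfolding hs_alt[OF c] by (simp add: mult.commute)
  also have "\<dots> = (\<Sum>i<d. 1)" by (intro sum.cong refl) (simp add: unitaryD[OF U])
  finally show ?thesis by simp
qed

lemma hs_unitary_left:
  assumes "unitary d U" "A \<in> carrier_mat d d" "B \<in> carrier_mat d d"
  shows "hs (U * A) (U * B) = hs A B"
proof -
  note c = unitary_carrier[OF assms(1)]
  have "hs (U * A) (U * B) = hs A (cadj U * (U * B))"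
    using hs_left_mult[OF c assms(2), of "U * B"] c assms by auto
  also have "cadj U * (U * B) = (cadj U * U) * B" using c assms(3) by (simp add: assoc_mult_mat[of _ d d _ d _ d])
  finally show ?thesis using assms by (simp add: unitary_left)
qed

lemma hs_unitary_right:
  assumes "unitary d U" "A \<in> carrier_mat d d" "B \<in> carrier_mat d d"
  shows "hs (A * U) (B * U) = hs A B"
proof -
  note c = unitary_carrier[OF assms(1)]
  have "hs (A * U) (B * U) = hs A ((B * U) * cadj U)"
    using hs_right_mult[OF assms(2) c, of "B * U"] c assms by auto
  also have "(B * U) * cadj U = B * (U * cadj U)" using c assms(3) by (simp add: assoc_mult_mat[of _ d d _ d _ d])
  finally show ?thesis using assms by (simp add: unitary_right)
qed

text \<open>The inner product of \<open>kron X (cconj X)\<close> and \<open>kron Y (cconj Y)\<close>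
  is the squared modulus of \<open>hs X Y\<close>. Expanding the squared Frobenius norm of the
  difference leaves two diagonal terms \<open>d^2\<close> and two equal cross terms.\<close>

lemma Dist_hs:
  assumes U: "unitary d U" and C: "unitary d C" and d: "d > 0"
  shows "(Dist U C)\<^sup>2 = 1 - (cmod (hs C U) / d)\<^sup>2"
proof -
  note u = unitary_carrier[OF U] and c = unitary_carrier[OF C]
  let ?K = "kron U (cconj U) - kron C (cconj C)"
  have cc: "cconj A \<in> carrier_mat d d" if "A \<in> carrier_mat d d" for A using that by (auto simp: cconj_def)
  have ccE: "cconj A $$ (i,j) = cnj (A $$ (i,j))" if "A \<in> carrier_mat d d" "i < d" "j < d" for A i j
    using that by (auto simp: cconj_def)
  have kk: "?K \<in> carrier_mat (d*d) (d*d)" using u c by (intro minus_carrier_mat kron_carrier cc)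
  have E: "?K $$ (i*d+k, j*d+l) = U$$(i,j) * cnj (U$$(k,l)) - C$$(i,j) * cnj (C$$(k,l))"
    if "i < d" "j < d" "k < d" "l < d" for i j k l
    using that u c by (simp add: kron_entry'[OF u cc[OF u]] kron_entry'[OF c cc[OF c]] ccE 
        add_lt_mult kron_carrier[OF u cc[OF u]] kron_carrier[OF c cc[OF c]] 
        carrier_matD[OF kron_carrier[OF c cc[OF c]]] carrier_matD[OF kron_carrier[OF u cc[OF u]]])
  \<comment> \<open>The inner product of \<open>kron X (cconj X)\<close> with
    \<open>kron Y (cconj Y)\<close>, its sums ordered so that it factors.\<close>
  define S where "S X Y = (\<Sum>i<d. \<Sum>j<d. \<Sum>k<d. \<Sum>l<d. (cnj (X$$(i,j)) * Y$$(i,j)) * cnj (cnj (X$$(k,l)) * Y$$(k,l)))"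
    for X Y :: "complex mat"
  have S: "S X Y = hs X Y * cnj (hs X Y)" if "X \<in> carrier_mat d d" for X Y
    unfolding S_def hs_alt[OF that]
    unfolding cnj_sum by (simp only: sum_distrib_right, simp only: sum_distrib_left)
  have "complex_of_real ((frob ?K)\<^sup>2) = hs ?K ?K"
    unfolding hs_self frob_def by (subst real_sqrt_pow2) (auto intro!: sum_nonneg)
  also have "\<dots> = (\<Sum>i<d. \<Sum>k<d. \<Sum>j<d. \<Sum>l<d. cnj (?K $$ (i*d+k, j*d+l)) * ?K $$ (i*d+k, j*d+l))"
    unfolding hs_alt[OF kk] sum_lessThan_mult ..
  also have "\<dots> = (\<Sum>i<d. \<Sum>j<d. \<Sum>k<d. \<Sum>l<d. cnj (?K $$ (i*d+k, j*d+l)) * ?K $$ (i*d+k, j*d+l))"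
    by (intro sum.cong refl sum.swap)
  also have "\<dots> = S U U - S U C - S C U + S C C"
    unfolding S_def sum_subtractf[symmetric] sum.distrib[symmetric]
    by (intro sum.cong refl) (simp only: E lessThan_iff, simp add: algebra_simps)
  also have "\<dots> = of_nat d * of_nat d - hs U C * cnj (hs U C) - hs C U * cnj (hs C U) + of_nat d * of_nat d"
    by (simp add: S u c hs_self_unitary[OF U] hs_self_unitary[OF C])
  also have "hs U C * cnj (hs U C) = hs C U * cnj (hs C U)"
    using hs_cnj[OF u c] hs_cnj[OF c u] by simp
  also have "hs C U * cnj (hs C U) = complex_of_real ((cmod (hs C U))\<^sup>2)" by (simp add: complex_norm_square del: of_real_power)
  finally have "complex_of_real ((frob ?K)\<^sup>2) = complex_of_real (2 * (real d)\<^sup>2 - 2 * (cmod (hs C U))\<^sup>2)"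
    by (simp add: power2_eq_square)
  then have f: "(frob ?K)\<^sup>2 = 2 * (real d)\<^sup>2 - 2 * (cmod (hs C U))\<^sup>2" by (simp only: of_real_eq_iff)
  have "(Dist U C)\<^sup>2 = (frob ?K)\<^sup>2 / (2 * (real d)\<^sup>2)"
    unfolding Dist_def using u by (simp add: power_divide)
  also have "\<dots> = 1 - (cmod (hs C U) / d)\<^sup>2" unfolding f using d by (simp add: power_divide field_simps)
  finally show ?thesis .
qed

section \<open>Pauli strings and Clifford unitaries\<close>

lemma pauli_carrier [simp, intro]: "pauli k \<in> carrier_mat 2 2"
  by (auto simp: pauli_def mat_of_rows_list_def)

lemma pauli_dim [simp]: "dim_row (pauli k) = 2" "dim_col (pauli k) = 2"
  using pauli_carrier[of k] by (auto simp del: pauli_carrier)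

lemma pauli_entries:
  "pauli 0 $$ (0,0) = 1" "pauli 0 $$ (0,Suc 0) = 0" "pauli 0 $$ (Suc 0,0) = 0" "pauli 0 $$ (Suc 0,Suc 0) = 1"
  "pauli (Suc 0) $$ (0,0) = 0" "pauli (Suc 0) $$ (0,Suc 0) = 1"
  "pauli (Suc 0) $$ (Suc 0,0) = 1" "pauli (Suc 0) $$ (Suc 0,Suc 0) = 0"
  "pauli 2 $$ (0,0) = 0" "pauli 2 $$ (0,Suc 0) = -\<i>" "pauli 2 $$ (Suc 0,0) = \<i>" "pauli 2 $$ (Suc 0,Suc 0) = 0"
  "pauli 3 $$ (0,0) = 1" "pauli 3 $$ (0,Suc 0) = 0" "pauli 3 $$ (Suc 0,0) = 0" "pauli 3 $$ (Suc 0,Suc 0) = -1"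
  by (simp_all add: pauli_def mat_of_rows_list_def)

lemma less_4_cases: "(k::nat) < 4 \<Longrightarrow> k = 0 \<or> k = 1 \<or> k = 2 \<or> k = 3"
  by auto

lemma mat2_eqI:
  fixes A B :: "complex mat"
  assumes "A \<in> carrier_mat 2 2" "B \<in> carrier_mat 2 2"
    "A $$ (0,0) = B $$ (0,0)" "A $$ (0,1) = B $$ (0,1)" "A $$ (1,0) = B $$ (1,0)" "A $$ (1,1) = B $$ (1,1)"
  shows "A = B"
  using assms by (intro eq_matI) (auto simp: less_2_cases_iff)

lemma mult2_entry:
  fixes A B :: "complex mat"
  assumes "A \<in> carrier_mat 2 2" "B \<in> carrier_mat 2 2" "i < 2" "j < 2"
  shows "(A * B) $$ (i,j) = A $$ (i,0) * B $$ (0,j) + A $$ (i,1) * B $$ (1,j)"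
  by (subst mult_entry[OF assms]) (simp add: numeral_2_eq_2)

lemma pauli_hs:
  assumes "k < 4" "l < 4"
  shows "hs (pauli k) (pauli l) = (if k = l then 2 else 0)"
proof -
  have two: "{..<2::nat} = {0, Suc 0}" by auto
  show ?thesis using less_4_cases[OF assms(1)] less_4_cases[OF assms(2)]
    by (elim disjE) (simp_all add: hs_alt[OF pauli_carrier] pauli_entries two)
qed

lemma pauli_cadj [simp]: "cadj (pauli k) = pauli k"
proof (cases "k < 4")
  case True
  show ?thesis using less_4_cases[OF True]
    by (elim disjE; intro mat2_eqI; simp add: pauli_entries cadj_entry[of _ 2 2])
qed (simp add: pauli_def)

lemma pauli_square: "pauli k * pauli k = 1\<^sub>m 2"
proof (cases "k < 4")
  case True
  have c: "pauli a * pauli b \<in> carrier_mat 2 2" for a b by (rule mult_carrier_mat) auto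
  show ?thesis using less_4_cases[OF True]
    by (elim disjE; intro mat2_eqI; simp add: c pauli_entries mult2_entry del: index_mult_mat(1))
qed (simp add: pauli_def)

lemma pauli_comm:
  "\<exists>s\<in>{1,-1}. pauli k * pauli l = s \<cdot>\<^sub>m (pauli l * pauli k)"
proof -
  have c: "pauli a * pauli b \<in> carrier_mat 2 2" for a b by (rule mult_carrier_mat) auto
  have *: "\<exists>s\<in>{1,-1}. pauli k * pauli l = s \<cdot>\<^sub>m (pauli l * pauli k)" if "k < 4" "l < 4" for k l
  proof -
    let ?s = "if k = 0 \<or> l = 0 \<or> k = l then 1 else (-1 :: complex)"
    have "pauli k * pauli l = ?s \<cdot>\<^sub>m (pauli l * pauli k)"
      using less_4_cases[OF that(1)] less_4_cases[OF that(2)]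
      by (elim disjE; intro mat2_eqI; simp add: c mult2_entry pauli_entries del: index_mult_mat(1))
    then show ?thesis by (intro bexI[of _ ?s]) auto
  qed
  \<comment> \<open>Every index above 3 denotes the identity, so the sixteen cases cover all
    indices.\<close>
  have m: "pauli a = pauli (if a < 4 then a else 0)" for a by (simp add: pauli_def)
  show ?thesis by (subst (1 2 3 4) m, rule *) auto
qed

lemma pauli_transpose: "\<exists>s\<in>{1,-1}. transpose_mat (pauli k) = s \<cdot>\<^sub>m pauli k"
proof (cases "k < 4")
  case True
  let ?s = "if k = 2 then -1 else (1 :: complex)"
  have "transpose_mat (pauli k) = ?s \<cdot>\<^sub>m pauli k"
    using less_4_cases[OF True]
    by (elim disjE; intro mat2_eqI; simp add: pauli_entries)
  then show ?thesis by (intro bexI[of _ ?s]) auto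
next
  case False
  then show ?thesis by (intro bexI[of _ 1]) (auto simp: pauli_def)
qed

text \<open>Strings are coded by the base 4 digits of \<open>r\<close>, most significant first,
  instead of lists, so that they can serve as row indices of matrices and as measurement
  outcomes.\<close>

fun ps :: "nat \<Rightarrow> nat \<Rightarrow> complex mat" where
  "ps 0 r = 1\<^sub>m 1"
| "ps (Suc n) r = kron (pauli (r div 4^n)) (ps n (r mod 4^n))"

lemma ps_carrier [simp, intro]: "ps n r \<in> carrier_mat (2^n) (2^n)"
  by (induction n arbitrary: r) auto

lemma ps_dim [simp]: "dim_row (ps n r) = 2^n" "dim_col (ps n r) = 2^n"
  using ps_carrier[of n r] by (auto simp del: ps_carrier)

lemma ps_zero: "ps n 0 = 1\<^sub>m (2^n)"
  by (induction n) (auto simp: pauli_def kron_one)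

lemma pauli_string_ps:
  assumes "set xs \<subseteq> {0..3}"
  shows "\<exists>r<4^length xs. pauli_string xs = ps (length xs) r"
  using assms
proof (induction xs)
  case (Cons k xs)
  then obtain r where r: "r < 4^length xs" "pauli_string xs = ps (length xs) r" by auto
  have k: "k < 4" using Cons.prems by auto
  show ?case
  proof (intro exI conjI)
    show "k * 4^length xs + r < 4^length (k # xs)" using add_lt_mult[OF k r(1)] by simp
    show "pauli_string (k # xs) = ps (length (k # xs)) (k * 4^length xs + r)"
      using r by (simp add: pauli_string_def)
  qed
qed (simp add: pauli_string_def)

lemma ps_pauli_string:
  assumes "r < 4^n"
  shows "\<exists>xs. length xs = n \<and> set xs \<subseteq> {0..3} \<and> ps n r = pauli_string xs"
  using assms
proof (induction n arbitrary: r)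
  case (Suc n)
  have r: "r < 4 * 4^n" using Suc.prems by simp
  obtain xs where xs: "length xs = n" "set xs \<subseteq> {0..3}" "ps n (r mod 4^n) = pauli_string xs"
    using Suc.IH[OF mod_lt_mult[OF r]] by auto
  have "r div 4^n < 4" using div_lt_mult[OF r] .
  then show ?case using xs
    by (intro exI[of _ "(r div 4^n) # xs"]) (auto simp: pauli_string_def)
qed (auto simp: pauli_string_def)

lemma pauli_group_ps: "pauli_group n = {(\<i> ^ k) \<cdot>\<^sub>m ps n r | k r. r < 4^n}"
  unfolding pauli_group_def using pauli_string_ps ps_pauli_string by (auto; metis)

lemma ps_cadj [simp]: "cadj (ps n r) = ps n r"
  by (induction n arbitrary: r) (auto simp: cadj_kron)

lemma ps_square: "ps n r * ps n r = 1\<^sub>m (2^n)"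
proof (induction n arbitrary: r)
  case (Suc n)
  have "ps (Suc n) r * ps (Suc n) r
      = kron (pauli (r div 4^n) * pauli (r div 4^n)) (ps n (r mod 4^n) * ps n (r mod 4^n))"
    by (simp, rule kron_mult) auto
  then show ?case by (simp add: Suc pauli_square kron_one del: ps.simps)
qed simp

lemma ps_unitary: "unitary (2^n) (ps n r)"
  by (simp add: unitary_def ps_square)

lemma sign_mult: "s \<in> {1,-1} \<Longrightarrow> t \<in> {1,-1} \<Longrightarrow> s * t \<in> {1,-1::complex}"
  by auto

lemma ps_comm: "\<exists>s\<in>{1,-1}. ps n p * ps n q = s \<cdot>\<^sub>m (ps n q * ps n p)"
proof (induction n arbitrary: p q)
  case (Suc n)
  have K: "ps (Suc n) a * ps (Suc n) b
      = kron (pauli (a div 4^n) * pauli (b div 4^n)) (ps n (a mod 4^n) * ps n (b mod 4^n))" for a b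
    by (simp, rule kron_mult) auto
  obtain s where s: "s \<in> {1,-1}"
    "pauli (p div 4^n) * pauli (q div 4^n) = s \<cdot>\<^sub>m (pauli (q div 4^n) * pauli (p div 4^n))"
    using pauli_comm by blast
  obtain t where t: "t \<in> {1,-1}"
    "ps n (p mod 4^n) * ps n (q mod 4^n) = t \<cdot>\<^sub>m (ps n (q mod 4^n) * ps n (p mod 4^n))"
    using Suc by blast
  have "ps (Suc n) p * ps (Suc n) q = (s * t) \<cdot>\<^sub>m (ps (Suc n) q * ps (Suc n) p)"
    unfolding K s(2) t(2) kron_smult ..
  with sign_mult[OF s(1) t(1)] show ?case by blast
qed (auto intro!: bexI[of _ 1])

lemma ps_transpose: "\<exists>s\<in>{1,-1}. transpose_mat (ps n p) = s \<cdot>\<^sub>m ps n p"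
proof (induction n arbitrary: p)
  case (Suc n)
  obtain s where s: "s \<in> {1,-1}" "transpose_mat (pauli (p div 4^n)) = s \<cdot>\<^sub>m pauli (p div 4^n)"
    using pauli_transpose by blast
  obtain t where t: "t \<in> {1,-1}" "transpose_mat (ps n (p mod 4^n)) = t \<cdot>\<^sub>m ps n (p mod 4^n)"
    using Suc by blast
  have "transpose_mat (ps (Suc n) p) = (s * t) \<cdot>\<^sub>m ps (Suc n) p"
    by (simp add: transpose_kron s(2) t(2) kron_smult)
  with sign_mult[OF s(1) t(1)] show ?case by blast
qed (auto intro!: bexI[of _ 1])

lemma smult_smult [simp]: "a \<cdot>\<^sub>m (b \<cdot>\<^sub>m A) = (a * b) \<cdot>\<^sub>m (A :: complex mat)"
  by (rule eq_matI) auto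

lemma mult_smult_left: 
  fixes A B :: "complex mat"
  shows "dim_col A = dim_row B \<Longrightarrow> (a \<cdot>\<^sub>m A) * B = a \<cdot>\<^sub>m (A * B)"
  by (rule mult_smult_assoc_mat) auto

lemma mult_smult_right: 
  fixes A B :: "complex mat"
  shows "dim_col A = dim_row B \<Longrightarrow> A * (a \<cdot>\<^sub>m B) = a \<cdot>\<^sub>m (A * B)"
  by (rule mult_smult_distrib) auto

lemma smult_one_mat [simp]: "(1::complex) \<cdot>\<^sub>m A = A"
  by (rule eq_matI) auto

lemma ps_conj_transpose:
  "\<exists>s\<in>{1,-1}. ps n p * ps n q * transpose_mat (ps n p) = s \<cdot>\<^sub>m ps n q"
proof -
  obtain s where s: "s \<in> {1,-1}" "transpose_mat (ps n p) = s \<cdot>\<^sub>m ps n p" using ps_transpose by blast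
  obtain t where t: "t \<in> {1,-1}" "ps n p * ps n q = t \<cdot>\<^sub>m (ps n q * ps n p)" using ps_comm by blast
  have "ps n p * ps n q * transpose_mat (ps n p) = (s * t) \<cdot>\<^sub>m (ps n q * (ps n p * ps n p))"
    unfolding s(2) t(2) by (simp add: mult_smult_left mult_smult_right mat_assoc)
  then have "ps n p * ps n q * transpose_mat (ps n p) = (s * t) \<cdot>\<^sub>m ps n q"
    using right_mult_one_mat[OF ps_carrier[of n q]] by (simp add: ps_square)
  with sign_mult[OF s(1) t(1)] show ?thesis by blast
qed

lemma hs_kron:
  assumes A: "A \<in> carrier_mat a b" and B: "B \<in> carrier_mat c e"
    and A': "A' \<in> carrier_mat a b" and B': "B' \<in> carrier_mat c e"
  shows "hs (kron A B) (kron A' B') = hs A A' * hs B B'"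
proof -
  have "hs (kron A B) (kron A' B') = (\<Sum>i<a. \<Sum>k<c. \<Sum>j<b. \<Sum>l<e.
     (cnj (A $$ (i,j)) * A' $$ (i,j)) * (cnj (B $$ (k,l)) * B' $$ (k,l)))"
    unfolding hs_alt[OF kron_carrier[OF A B]] sum_lessThan_mult
    by (intro sum.cong refl) (simp add: kron_entry'[OF A B] kron_entry'[OF A' B'])
  also have "\<dots> = (\<Sum>i<a. \<Sum>j<b. \<Sum>k<c. \<Sum>l<e.
     (cnj (A $$ (i,j)) * A' $$ (i,j)) * (cnj (B $$ (k,l)) * B' $$ (k,l)))"
    by (intro sum.cong refl sum.swap)
  also have "\<dots> = hs A A' * hs B B'"
    unfolding hs_alt[OF A] hs_alt[OF B] by (simp only: sum_distrib_right, simp only: sum_distrib_left)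
  finally show ?thesis .
qed

lemma hs_ps:
  assumes "p < 4^n" "q < 4^n"
  shows "hs (ps n p) (ps n q) = (if p = q then 2^n else 0)"
  using assms
proof (induction n arbitrary: p q)
  case (Suc n)
  have p: "p < 4 * 4^n" and q: "q < 4 * 4^n" using Suc.prems by auto
  have "hs (ps (Suc n) p) (ps (Suc n) q)
     = hs (pauli (p div 4^n)) (pauli (q div 4^n)) * hs (ps n (p mod 4^n)) (ps n (q mod 4^n))"
    by (simp, rule hs_kron[of _ 2 2 _ "2^n" "2^n"]) auto
  also have "\<dots> = (if p = q then 2^Suc n else 0)"
    using Suc.IH[OF mod_lt_mult[OF p] mod_lt_mult[OF q]] pauli_hs[OF div_lt_mult[OF p] div_lt_mult[OF q]]
      divmod_eq_iff[of p q "4^n"]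
    by auto
  finally show ?case .
qed (simp add: hs_def)

text \<open>Row \<open>s\<close> is the bra of the Choi state of \<open>C * ps n s\<close>.\<close>

definition pbasis :: "nat \<Rightarrow> complex mat \<Rightarrow> complex mat" where
  "pbasis n C = mat (4^n) (4^n)
     (\<lambda>(s,y). cnj ((C * ps n s) $$ (y div 2^n, y mod 2^n)) / complex_of_real (sqrt (2^n)))"

lemma four_pow: "(4::'a::comm_semiring_1)^n = 2^n * 2^n"
proof -
  have "(4::'a) = 2 * 2" by simp
  then show ?thesis by (simp only: power_mult_distrib)
qed

lemma pbasis_carrier [simp, intro]: "pbasis n C \<in> carrier_mat (4^n) (4^n)"
  by (simp add: pbasis_def)

lemma pbasis_entry:
  assumes "s < 4^n" "i < 2^n" "j < 2^n"
  shows "pbasis n C $$ (s, i*2^n+j) = cnj ((C * ps n s) $$ (i,j)) / complex_of_real (sqrt (2^n))"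
  using assms add_lt_mult[of i "2^n" j "2^n"] by (simp add: pbasis_def four_pow)

lemma sqrt_2n: "complex_of_real (sqrt (2^n)) * complex_of_real (sqrt (2^n)) = 2^n"
  unfolding of_real_mult[symmetric] by simp

lemma pbasis_unitary:
  assumes C: "unitary (2^n) C"
  shows "unitary (4^n) (pbasis n C)"
proof (rule unitaryI)
  fix s t :: nat assume st: "s < 4^n" "t < 4^n"
  note c = unitary_carrier[OF C]
  have cr: "C * ps n u \<in> carrier_mat (2^n) (2^n)" for u using c by auto
  have "(\<Sum>k<4^n. pbasis n C $$ (s,k) * cnj (pbasis n C $$ (t,k)))
      = (\<Sum>i<2^n. \<Sum>j<2^n. cnj ((C * ps n s) $$ (i,j)) * (C * ps n t) $$ (i,j) / 2^n)"
    unfolding four_pow sum_lessThan_mult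
    using st by (intro sum.cong refl)
      (simp add: pbasis_entry sqrt_2n del: index_mult_mat flip: of_real_mult)
  also have "\<dots> = hs (C * ps n s) (C * ps n t) / 2^n"
    by (simp add: hs_alt[OF cr] sum_divide_distrib)
  also have "\<dots> = (if s = t then 1 else 0)"
    by (simp add: hs_unitary_left[OF C] hs_ps[OF st])
  finally show "(\<Sum>k<4^n. pbasis n C $$ (s,k) * cnj (pbasis n C $$ (t,k))) = (if s = t then 1 else 0)" .
qed auto

text \<open>The rows of \<open>pbasis n (1\<^sub>m (2^n))\<close> are orthonormal because the
  strings are orthogonal; a square matrix then has orthonormal columns too, and this is
  completeness.\<close>

lemma ps_complete:
  assumes ij: "i < 2^n" "j < 2^n" "k < 2^n" "l < 2^n"
  shows "(\<Sum>s<4^n. cnj (ps n s $$ (i,j)) * ps n s $$ (k,l)) = (if i = k \<and> j = l then 2^n else 0)"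
proof -
  let ?B = "pbasis n (1\<^sub>m (2^n))"
  note U = unitary_cadj[OF pbasis_unitary[OF unitary_one]]
  have lt: "i * 2^n + j < 4^n" "k * 2^n + l < 4^n"
    using ij by (auto simp: four_pow add_lt_mult)
  have "(\<Sum>s<4^n. cadj ?B $$ (k*2^n+l, s) * cnj (cadj ?B $$ (i*2^n+j, s))) 
      = (if k*2^n+l = i*2^n+j then 1 else 0)"
    by (rule unitaryD[OF U lt(2,1)])
  also have "(\<Sum>s<4^n. cadj ?B $$ (k*2^n+l, s) * cnj (cadj ?B $$ (i*2^n+j, s)))
     = (\<Sum>s<4^n. cnj (ps n s $$ (i,j)) * ps n s $$ (k,l)) / 2^n"
    unfolding sum_divide_distrib
    using ij lt by (intro sum.cong refl)
      (simp add: cadj_entry[OF pbasis_carrier] pbasis_entry left_mult_one_mat[OF ps_carrier] sqrt_2n 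
         mult.commute flip: of_real_mult)
  also have "(k*2^n+l = i*2^n+j) \<longleftrightarrow> (i = k \<and> j = l)"
    using divmod_eq_iff[of "k*2^n+l" "i*2^n+j" "2^n"] ij by auto
  finally show ?thesis by (simp add: field_simps split: if_splits)
qed

lemma ps_parseval:
  assumes M: "M \<in> carrier_mat (2^n) (2^n)" and N: "N \<in> carrier_mat (2^n) (2^n)"
  shows "(\<Sum>r<4^n. cnj (hs (ps n r) M) * hs (ps n r) N) = 2^n * hs M N"
proof -
  let ?d = "2^n :: nat"
  have z: "(if P then a else 0) * b = (if P then a * b else 0)" for P and a b :: complex by simp
  have "(\<Sum>r<4^n. cnj (hs (ps n r) M) * hs (ps n r) N)
     = (\<Sum>r<4^n. \<Sum>i<?d. \<Sum>j<?d. \<Sum>k<?d. \<Sum>l<?d.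
         (cnj (ps n r $$ (k,l)) * ps n r $$ (i,j)) * (cnj (M $$ (i,j)) * N $$ (k,l)))"
    unfolding hs_alt[OF ps_carrier] cnj_sum
    by (simp only: sum_distrib_right, simp only: sum_distrib_left) (simp add: mult_ac)
  also have "\<dots> = (\<Sum>i<?d. \<Sum>r<4^n. \<Sum>j<?d. \<Sum>k<?d. \<Sum>l<?d.
         (cnj (ps n r $$ (k,l)) * ps n r $$ (i,j)) * (cnj (M $$ (i,j)) * N $$ (k,l)))"
    by (rule sum.swap)
  also have "\<dots> = (\<Sum>i<?d. \<Sum>j<?d. \<Sum>r<4^n. \<Sum>k<?d. \<Sum>l<?d.
         (cnj (ps n r $$ (k,l)) * ps n r $$ (i,j)) * (cnj (M $$ (i,j)) * N $$ (k,l)))"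
    by (intro sum.cong refl sum.swap)
  also have "\<dots> = (\<Sum>i<?d. \<Sum>j<?d. \<Sum>k<?d. \<Sum>r<4^n. \<Sum>l<?d.
         (cnj (ps n r $$ (k,l)) * ps n r $$ (i,j)) * (cnj (M $$ (i,j)) * N $$ (k,l)))"
    by (intro sum.cong refl sum.swap)
  also have "\<dots> = (\<Sum>i<?d. \<Sum>j<?d. \<Sum>k<?d. \<Sum>l<?d. \<Sum>r<4^n.
         (cnj (ps n r $$ (k,l)) * ps n r $$ (i,j)) * (cnj (M $$ (i,j)) * N $$ (k,l)))"
    by (intro sum.cong refl sum.swap)
  also have "\<dots> = (\<Sum>i<?d. \<Sum>j<?d. \<Sum>k<?d.
         if k = i then (\<Sum>l<?d. if l = j then 2^n * (cnj (M $$ (i,j)) * N $$ (k,l)) else 0) else 0)"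
    by (intro sum.cong refl)
      (auto simp: ps_complete z simp flip: sum_distrib_right)
  also have "\<dots> = (\<Sum>i<?d. \<Sum>j<?d. 2^n * (cnj (M $$ (i,j)) * N $$ (i,j)))"
    by (intro sum.cong refl) simp
  also have "\<dots> = 2^n * hs M N" by (simp add: hs_alt[OF M] sum_distrib_left)
  finally show ?thesis .
qed

text \<open>Twirling: by completeness the sum of all \<open>ps n q * A * ps n q\<close> is
  \<open>2^n\<close> times the trace of \<open>A\<close> times the identity, whereas commutation
  makes it \<open>4^n\<close> times \<open>A\<close>.\<close>

lemma ps_commutant:
  assumes A: "A \<in> carrier_mat (2^n) (2^n)" and comm: "\<And>q. q < 4^n \<Longrightarrow> ps n q * A = A * ps n q"
  shows "\<exists>c. A = c \<cdot>\<^sub>m 1\<^sub>m (2^n)"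
proof -
  let ?d = "2^n :: nat"
  define t where "t = (\<Sum>i<?d. A $$ (i,i))"
  have "A $$ (i,l) = (t / 2^n) * (if i = l then 1 else 0)" if il: "i < ?d" "l < ?d" for i l
  proof -
    have "(4^n::complex) * A $$ (i,l) = (\<Sum>q<4^n. (ps n q * A * ps n q) $$ (i,l))"
    proof -
      have "ps n q * A * ps n q = A" if "q < 4^n" for q
        using comm[OF that] A by (simp add: mat_assoc ps_square)
      then show ?thesis by simp
    qed
    also have "\<dots> = (\<Sum>q<4^n. \<Sum>k<?d. \<Sum>j<?d. cnj (ps n q $$ (l,k)) * ps n q $$ (i,j) * A $$ (j,k))"
    proof (intro sum.cong refl)
      fix q
      have h: "ps n q $$ (k,l) = cnj (ps n q $$ (l,k))" if "k < ?d" for k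
        using cadj_entry[OF ps_carrier[of n q], of k l] that il by simp
      show "(ps n q * A * ps n q) $$ (i,l) = (\<Sum>k<?d. \<Sum>j<?d. cnj (ps n q $$ (l,k)) * ps n q $$ (i,j) * A $$ (j,k))"
        using il
        by (simp add: mult_entry[OF mult_carrier_mat[OF ps_carrier A] ps_carrier] mult_entry[OF ps_carrier A] h
            sum_distrib_right sum_distrib_left mult_ac del: index_mult_mat)
    qed
    also have "\<dots> = (\<Sum>k<?d. \<Sum>q<4^n. \<Sum>j<?d. cnj (ps n q $$ (l,k)) * ps n q $$ (i,j) * A $$ (j,k))"
      by (rule sum.swap)
    also have "\<dots> = (\<Sum>k<?d. \<Sum>j<?d. \<Sum>q<4^n. cnj (ps n q $$ (l,k)) * ps n q $$ (i,j) * A $$ (j,k))"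
      by (intro sum.cong refl sum.swap)
    also have "\<dots> = (\<Sum>k<?d. \<Sum>j<?d. if j = k then (if i = l then 2^n * A $$ (j,k) else 0) else 0)"
      using il by (intro sum.cong refl) (auto simp: ps_complete simp flip: sum_distrib_right)
    also have "\<dots> = 2^n * (if i = l then t else 0)"
      by (simp add: t_def sum_distrib_left)
    finally have "(2^n::complex) * (2^n * A $$ (i,l)) = 2^n * (if i = l then t else 0)"
      by (simp only: four_pow mult.assoc)
    then have "2^n * A $$ (i,l) = (if i = l then t else 0)" by (simp only: mult_cancel_left) simp
    then show ?thesis by (auto simp: field_simps)
  qed
  then have "A = (t / 2^n) \<cdot>\<^sub>m 1\<^sub>m (2^n)"
    using A by (intro eq_matI) auto
  then show ?thesis ..
qed

lemma hs_one: "M \<in> carrier_mat d d \<Longrightarrow> hs (1\<^sub>m d) M = (\<Sum>i<d. M $$ (i,i))"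
proof -
  assume M: "M \<in> carrier_mat d d"
  have "hs (1\<^sub>m d) M = (\<Sum>i<d. \<Sum>j<d. if j = i then M $$ (i,j) else 0)"
    unfolding hs_alt[OF one_carrier_mat] by (intro sum.cong refl) auto
  then show ?thesis by simp
qed

lemma clifford_unitary: "C \<in> clifford n \<Longrightarrow> unitary (2^n) C"
  by (simp add: clifford_def)

text \<open>Conjugation by a unitary keeps matrices Hermitian, so the phase \<open>\<i>^k\<close>
  allowed by \<open>pauli_group\<close> has to be real.\<close>

lemma clifford_ps:
  assumes C: "C \<in> clifford n" and q: "q < 4^n"
  shows "\<exists>p<4^n. \<exists>s\<in>{1,-1}. C * ps n q * cadj C = s \<cdot>\<^sub>m ps n p"
proof -
  note U = clifford_unitary[OF C]
  note c = unitary_carrier[OF U]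
  let ?A = "C * ps n q * cadj C"
  have A: "?A \<in> carrier_mat (2^n) (2^n)" using c by auto
  have "\<i>^0 \<cdot>\<^sub>m ps n q \<in> pauli_group n" unfolding pauli_group_ps using q by blast
  then have "?A \<in> pauli_group n" using C by (simp add: clifford_def)
  then obtain k p where p: "p < 4^n" and e: "?A = (\<i>^k) \<cdot>\<^sub>m ps n p" unfolding pauli_group_ps by blast
  have "cadj ?A = ?A" using c by (simp add: cadj_mult_dim mat_assoc)
  then have "cnj (\<i>^k) \<cdot>\<^sub>m ps n p = (\<i>^k) \<cdot>\<^sub>m ps n p" unfolding e by (simp add: cadj_smult)
  then have "hs (ps n p) (cnj (\<i>^k) \<cdot>\<^sub>m ps n p) = hs (ps n p) ((\<i>^k) \<cdot>\<^sub>m ps n p)" by simp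
  then have re: "cnj (\<i>^k) = \<i>^k" by (simp add: hs_smult_right[OF ps_carrier ps_carrier] hs_ps[OF p p])
  have "(\<i>^k) * cnj (\<i>^k) = 1" by (simp add: power_mult_distrib[symmetric])
  then have "(\<i>^k) * (\<i>^k) = 1" unfolding re .
  then have "\<i>^k \<in> {1,-1}" using square_eq_1_iff[of "\<i>^k"] by simp
  with p e show ?thesis by blast
qed

text \<open>\<open>corr U P Q\<close> is the expectation of \<open>P \<otimes> Q\<^sup>T\<close> in the Choi state of \<open>U\<close>.\<close>

definition corr :: "nat \<Rightarrow> complex mat \<Rightarrow> complex mat \<Rightarrow> complex mat \<Rightarrow> real" where
  "corr n U P Q = Re (hs U (P * U * Q)) / 2^n"

lemma hs_corr:
  assumes U: "U \<in> carrier_mat (2^n) (2^n)" 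
    and P: "P \<in> carrier_mat (2^n) (2^n)" "cadj P = P" and Q: "Q \<in> carrier_mat (2^n) (2^n)" "cadj Q = Q"
  shows "hs U (P * U * Q) = complex_of_real (2^n * corr n U P Q)"
proof -
  have PU: "P * U \<in> carrier_mat (2^n) (2^n)" "P * U * Q \<in> carrier_mat (2^n) (2^n)" using U P Q by auto
  have "hs (P * U * Q) U = hs (P * U) (U * Q)"
    using hs_right_mult[OF PU(1) Q(1) U] Q by simp
  also have "\<dots> = hs U (P * (U * Q))"
    using hs_left_mult[OF P(1) U, of "U * Q"] U P Q by auto
  also have "\<dots> = hs U (P * U * Q)" using U P Q by (simp add: mat_assoc)
  finally have "cnj (hs U (P * U * Q)) = hs U (P * U * Q)" using hs_cnj[OF U PU(2)] by simp
  then have "hs U (P * U * Q) \<in> \<real>" by (simp add: Reals_cnj_iff)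
  then have "hs U (P * U * Q) = complex_of_real (Re (hs U (P * U * Q)))" by simp
  then show ?thesis by (simp add: corr_def)
qed

text \<open>Write \<open>U = a C + Y\<close> with \<open>Y\<close> orthogonal to \<open>C\<close>.
  The map sending \<open>X\<close> to \<open>P * X * Q\<close> is an isometry fixing
  \<open>C\<close>, so it also keeps \<open>Y\<close> orthogonal to \<open>C\<close>. The part along
  \<open>C\<close> contributes \<open>|a|^2\<close>, and \<open>Y\<close> contributes at least minus
  its squared norm, that is \<open>-(1 - |a|^2)\<close> after normalisation.\<close>

lemma corr_stabilizer:
  assumes U: "unitary (2^n) U" and C: "unitary (2^n) C"
    and P: "unitary (2^n) P" and Q: "unitary (2^n) Q" and PCQ: "P * C * Q = C"
  shows "corr n U P Q \<ge> 2 * (cmod (hs C U) / 2^n)\<^sup>2 - 1"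
proof -
  let ?d = "2^n :: nat"
  note c = unitary_carrier[OF U] unitary_carrier[OF C] unitary_carrier[OF P] unitary_carrier[OF Q]
  define a where "a = hs C U / 2^n"
  define Y where "Y = U - a \<cdot>\<^sub>m C"
  define Z where "Z = P * Y * Q"
  have Y: "Y \<in> carrier_mat ?d ?d" unfolding Y_def using c by (auto intro: minus_carrier_mat)
  have Z: "Z \<in> carrier_mat ?d ?d" unfolding Z_def using c Y by auto
  have aC: "a \<cdot>\<^sub>m C \<in> carrier_mat ?d ?d" using c by simp
  have CY: "hs C Y = 0"
    unfolding Y_def hs_minus_right[OF c(2,1) aC] hs_smult_right[OF c(2) c(2)] hs_self_unitary[OF C]
    by (simp add: a_def)
  then have YC: "hs Y C = 0" using hs_cnj[OF c(2) Y] by simp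
  \<comment> \<open>A difference with a negated term, to fit \<open>hs_minus_left\<close> and
    \<open>hs_minus_right\<close>.\<close>
  have Udec: "U = a \<cdot>\<^sub>m C - (- 1) \<cdot>\<^sub>m Y" unfolding Y_def using c by (intro eq_matI) auto
  have nY: "(-1) \<cdot>\<^sub>m Y \<in> carrier_mat ?d ?d" using Y by simp
  have ZC: "hs C Z = 0"
  proof -
    have "hs C Z = hs (P * C * Q) (P * Y * Q)" unfolding Z_def PCQ ..
    also have "\<dots> = hs C Y" using c Y by (simp add: hs_unitary_right[OF Q] hs_unitary_left[OF P])
    finally show ?thesis using CY by simp
  qed
  have PUQ: "P * U * Q = a \<cdot>\<^sub>m C - (-1) \<cdot>\<^sub>m Z"
  proof -
    have "P * U * Q = P * (a \<cdot>\<^sub>m C) * Q - P * ((-1) \<cdot>\<^sub>m Y) * Q"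
      by (subst Udec) (use c Y in \<open>simp add: mult_minus_distrib_mat[of _ ?d ?d _ ?d] minus_mult_distrib_mat[of _ ?d ?d _ _ ?d]\<close>)
    then show ?thesis using c Y PCQ by (simp add: mult_smult_left mult_smult_right Z_def)
  qed
  have cU: "a \<cdot>\<^sub>m C - (-1) \<cdot>\<^sub>m Y \<in> carrier_mat ?d ?d" using aC nY by (intro minus_carrier_mat)
  have nZ: "(-1) \<cdot>\<^sub>m Z \<in> carrier_mat ?d ?d" using Z by simp
  have "hs U (P * U * Q) = cnj a * a * 2^n + hs Y Z"
    unfolding PUQ
    by (subst Udec) (simp add: hs_minus_right[OF cU aC nZ] hs_minus_left[OF aC nY aC] hs_minus_left[OF aC nY nZ]
        hs_smult_left hs_smult_right[OF c(2) c(2)] hs_smult_right[OF c(2) Z] hs_smult_right[OF Y c(2)]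
        hs_smult_right[OF Y Z] ZC YC hs_self_unitary[OF C])
  moreover have "hs U U = cnj a * a * 2^n + hs Y Y"
    by (subst (1 2) Udec) (simp add: hs_minus_right[OF cU aC nY] hs_minus_left[OF aC nY aC] hs_minus_left[OF aC nY nY]
        hs_smult_left hs_smult_right[OF c(2) c(2)] hs_smult_right[OF c(2) Y] hs_smult_right[OF Y c(2)]
        hs_smult_right[OF Y Y] CY YC hs_self_unitary[OF C])
  \<comment> \<open>The squared norm of \<open>Y + Z\<close> is nonnegative, and \<open>Z\<close> is
    as long as \<open>Y\<close>.\<close>
  moreover have "Re (hs Y Z) \<ge> - Re (hs Y Y)"
  proof -
    have ZZ: "hs Z Z = hs Y Y" unfolding Z_def using c Y by (simp add: hs_unitary_right[OF Q] hs_unitary_left[OF P])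
    have W: "Y - (-1) \<cdot>\<^sub>m Z \<in> carrier_mat ?d ?d" using Y nZ by (intro minus_carrier_mat)
    have "0 \<le> Re (hs (Y - (-1) \<cdot>\<^sub>m Z) (Y - (-1) \<cdot>\<^sub>m Z))" by (rule hs_self_nonneg)
    also have "hs (Y - (-1) \<cdot>\<^sub>m Z) (Y - (-1) \<cdot>\<^sub>m Z) = hs Y Y + hs Y Z + hs Z Y + hs Z Z"
      using Y Z nZ by (simp add: hs_minus_right[OF W Y nZ] hs_minus_left[OF Y nZ] hs_smult_left hs_smult_right[of _ ?d ?d] 
         hs_minus_left[OF Y nZ Y] hs_minus_left[OF Y nZ Z] hs_smult_right[OF W Z])
    also have "Re \<dots> = 2 * Re (hs Y Y) + 2 * Re (hs Y Z)" using hs_cnj[OF Y Z, symmetric] ZZ by simp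
    finally show ?thesis by simp
  qed
  ultimately have "Re (hs U (P * U * Q)) \<ge> 2 * Re (cnj a * a * 2^n) - Re (hs U U)" by simp
  also have "cnj a * a = complex_of_real ((cmod a)\<^sup>2)" by (simp add: complex_norm_square mult.commute del: of_real_power)
  also have "Re (complex_of_real ((cmod a)\<^sup>2) * 2^n) = (cmod a)\<^sup>2 * 2^n"
  proof -
    have "(2::complex)^n = complex_of_real (2^n)" by simp
    then show ?thesis by (simp only: of_real_mult[symmetric] Re_complex_of_real)
  qed
  finally have "Re (hs U (P * U * Q)) \<ge> 2 * ((cmod a)\<^sup>2 * 2^n) - 2^n"
    by (simp add: hs_self_unitary[OF U] del: of_real_mult)
  then have "corr n U P Q \<ge> 2 * (cmod a)\<^sup>2 - 1" by (simp add: corr_def field_simps)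
  then show ?thesis by (simp add: a_def norm_divide norm_power)
qed

text \<open>The matrices \<open>A = P * U * Q\<close> and \<open>B = P' * U * Q'\<close> have the
  length of \<open>U\<close>, and anticommutation makes the real part of \<open>hs A B\<close>
  vanish. The two correlations are then the coefficients of \<open>U\<close> along two vectors that
  are orthonormal over the reals, and Bessel's inequality applies.\<close>

lemma corr_anticommute:
  assumes U: "unitary (2^n) U"
    and P: "unitary (2^n) P" "cadj P = P" and Q: "unitary (2^n) Q" "cadj Q = Q"
    and P': "unitary (2^n) P'" "cadj P' = P'" and Q': "unitary (2^n) Q'" "cadj Q' = Q'"
    and anti: "P * P' * U * Q' * Q = (-1) \<cdot>\<^sub>m (P' * P * U * Q * Q')"
  shows "(corr n U P Q)\<^sup>2 + (corr n U P' Q')\<^sup>2 \<le> 1"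
proof -
  let ?d = "2^n :: nat"
  note c = unitary_carrier[OF U] unitary_carrier[OF P(1)] unitary_carrier[OF Q(1)]
    unitary_carrier[OF P'(1)] unitary_carrier[OF Q'(1)]
  define t t' where "t = complex_of_real (corr n U P Q)" and "t' = complex_of_real (corr n U P' Q')"
  define A B where "A = P * U * Q" and "B = P' * U * Q'"
  have A: "A \<in> carrier_mat ?d ?d" and B: "B \<in> carrier_mat ?d ?d" unfolding A_def B_def using c by auto
  have UA: "hs U A = 2^n * t" "hs A U = 2^n * t"
    using hs_corr[OF c(1) c(2) P(2) c(3) Q(2)] hs_cnj[OF c(1) A] by (auto simp: A_def t_def)
  have UB: "hs U B = 2^n * t'" "hs B U = 2^n * t'"
    using hs_corr[OF c(1) c(4) P'(2) c(5) Q'(2)] hs_cnj[OF c(1) B] by (auto simp: B_def t'_def)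
  have AA: "hs A A = 2^n" unfolding A_def using c by (simp add: hs_unitary_right[OF Q(1)] hs_unitary_left[OF P(1)] hs_self_unitary[OF U])
  have BB: "hs B B = 2^n" unfolding B_def using c by (simp add: hs_unitary_right[OF Q'(1)] hs_unitary_left[OF P'(1)] hs_self_unitary[OF U])
  have AB: "hs A B = hs U (P * P' * U * Q' * Q)"
  proof -
    have "hs A B = hs (P * U) (B * Q)" unfolding A_def using hs_right_mult[of "P * U" ?d ?d Q ?d B] c B Q by simp
    also have "\<dots> = hs U (P * (B * Q))" using hs_left_mult[of P ?d ?d U ?d "B * Q"] c B P by simp
    finally show ?thesis using c by (simp add: B_def mat_assoc)
  qed
  have BA: "hs B A = hs U (P' * P * U * Q * Q')"
  proof -
    have "hs B A = hs (P' * U) (A * Q')" unfolding B_def using hs_right_mult[of "P' * U" ?d ?d Q' ?d A] c A Q' by simp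
    also have "\<dots> = hs U (P' * (A * Q'))" using hs_left_mult[of P' ?d ?d U ?d "A * Q'"] c A P' by simp
    finally show ?thesis using c by (simp add: A_def mat_assoc)
  qed
  have cc: "P' * P * U * Q * Q' \<in> carrier_mat ?d ?d" using c by auto
  have anti': "hs A B = - hs B A" unfolding AB BA anti using hs_smult_right[OF c(1) cc, of "-1"] by simp
  \<comment> \<open>The residual of the projection; in its squared norm the mixed terms cancel by
    \<open>anti'\<close>.\<close>
  define X where "X = U - t \<cdot>\<^sub>m A - t' \<cdot>\<^sub>m B"
  have tA: "t \<cdot>\<^sub>m A \<in> carrier_mat ?d ?d" "t' \<cdot>\<^sub>m B \<in> carrier_mat ?d ?d" using A B by auto
  have V: "U - t \<cdot>\<^sub>m A \<in> carrier_mat ?d ?d" using c tA by (intro minus_carrier_mat)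
  have X: "X \<in> carrier_mat ?d ?d" unfolding X_def using V tA by (intro minus_carrier_mat)
  have r: "hs X M = hs U M - t * hs A M - t' * hs B M" if "M \<in> carrier_mat ?d ?d" for M
    unfolding X_def hs_minus_left[OF V tA(2) that] hs_minus_left[OF c(1) tA(1) that] hs_smult_left
    by (simp add: t_def t'_def)
  have "hs X X = hs X U - t * hs X A - t' * hs X B"
    by (subst (2) X_def) (simp add: hs_minus_right[OF X V tA(2)] hs_minus_right[OF X c(1) tA(1)] hs_smult_right[OF X A] hs_smult_right[OF X B])
  also have "\<dots> = 2^n - 2^n * t * t - 2^n * t' * t'"
    by (simp add: r[OF c(1)] r[OF A] r[OF B] UA UB AA BB hs_self_unitary[OF U] anti' algebra_simps)
  finally have "0 \<le> Re (2^n - 2^n * t * t - 2^n * t' * t')" using hs_self_nonneg[of X] by simp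
  also have "2^n - 2^n * t * t - 2^n * t' * t' = complex_of_real (2^n * (1 - (corr n U P Q)\<^sup>2 - (corr n U P' Q')\<^sup>2))"
    by (simp add: t_def t'_def power2_eq_square algebra_simps)
  finally have "0 \<le> 2^n * (1 - (corr n U P Q)\<^sup>2 - (corr n U P' Q')\<^sup>2)" by (simp del: of_real_mult of_real_diff)
  then have "0 \<le> 1 - (corr n U P Q)\<^sup>2 - (corr n U P' Q')\<^sup>2" 
    using mult_le_cancel_left_pos[of "2^n :: real" 0 "1 - (corr n U P Q)\<^sup>2 - (corr n U P' Q')\<^sup>2"] by simp
  then show ?thesis by simp
qed

text \<open>Equal commutation signs cancel in \<open>ps n r * A\<close>, which therefore commutes
  with every string and is scalar by \<open>ps_commutant\<close>.\<close>

lemma ps_separated: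
  assumes A: "A \<in> carrier_mat (2^n) (2^n)" and r: "r < 4^n"
    and same: "\<And>q. q < 4^n \<Longrightarrow> \<exists>s\<in>{1,-1}. ps n q * A = s \<cdot>\<^sub>m (A * ps n q) \<and> ps n q * ps n r = s \<cdot>\<^sub>m (ps n r * ps n q)"
  shows "\<exists>c. A = c \<cdot>\<^sub>m ps n r"
proof -
  let ?R = "ps n r"
  have "ps n q * (?R * A) = ?R * A * ps n q" if q: "q < 4^n" for q
  proof -
    obtain s where s: "s \<in> {1,-1}" "ps n q * A = s \<cdot>\<^sub>m (A * ps n q)" "ps n q * ?R = s \<cdot>\<^sub>m (?R * ps n q)"
      using same[OF q] by blast
    have "ps n q * (?R * A) = (ps n q * ?R) * A" using A by (simp add: mat_assoc)
    also have "\<dots> = s \<cdot>\<^sub>m (?R * (ps n q * A))" unfolding s(3) using A by (simp add: mat_assoc mult_smult_left)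
    also have "\<dots> = (s * s) \<cdot>\<^sub>m (?R * A * ps n q)" unfolding s(2) using A by (simp add: mat_assoc mult_smult_right)
    also have "s * s = 1" using s(1) by auto
    finally show ?thesis by simp
  qed
  from ps_commutant[OF mult_carrier_mat[OF ps_carrier A] this]
  obtain c where c: "?R * A = c \<cdot>\<^sub>m 1\<^sub>m (2^n)" by blast
  have "A = ?R * (?R * A)" using A by (simp add: ps_square flip: mat_assoc)
  also have "\<dots> = c \<cdot>\<^sub>m ?R" unfolding c by (simp add: mult_smult_right right_mult_one_mat[OF ps_carrier])
  finally show ?thesis ..
qed

text \<open>The action of \<open>C\<close> on strings, from the last argument to the one before it,
  with the sign dropped: squared correlations cannot reveal it.\<close>

definition related :: "nat \<Rightarrow> complex mat \<Rightarrow> nat \<Rightarrow> nat \<Rightarrow> bool" where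
  "related n C p q \<longleftrightarrow> (\<exists>s\<in>{1,-1}. C * ps n q * cadj C = s \<cdot>\<^sub>m ps n p)"

lemma related_ex: "C \<in> clifford n \<Longrightarrow> q < 4^n \<Longrightarrow> \<exists>p<4^n. related n C p q"
  using clifford_ps by (auto simp: related_def)

text \<open>Once the sign is absorbed into the left observable, the pair stabilizes
  \<open>C\<close>.\<close>

lemma corr_related:
  assumes U: "unitary (2^n) U" and C: "unitary (2^n) C" and rel: "related n C p q"
  shows "\<bar>corr n U (ps n p) (ps n q)\<bar> \<ge> 2 * (cmod (hs C U) / 2^n)\<^sup>2 - 1"
proof -
  note c = unitary_carrier[OF C] unitary_carrier[OF U]
  obtain s where s: "s \<in> {1,-1}" "C * ps n q * cadj C = s \<cdot>\<^sub>m ps n p"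
    using rel unfolding related_def by blast
  have ss: "s * s = 1" "cnj s = s" using s by auto
  let ?P = "s \<cdot>\<^sub>m ps n p"
  have P: "unitary (2^n) ?P"
    using ss by (simp add: unitary_def cadj_smult mult_smult_left mult_smult_right ps_square)
  have "?P * C * ps n q = C * (ps n q * (cadj C * C)) * ps n q" unfolding s(2)[symmetric] using c by (simp add: mat_assoc)
  also have "\<dots> = C * (ps n q * ps n q)" using c by (simp add: unitary_left[OF C] right_mult_one_mat[OF ps_carrier] mat_assoc)
  also have "\<dots> = C" using c by (simp add: ps_square)
  finally have "corr n U ?P (ps n q) \<ge> 2 * (cmod (hs C U) / 2^n)\<^sup>2 - 1"
    by (rule corr_stabilizer[OF U C P ps_unitary])
  moreover have PUQ: "ps n p * U * ps n q \<in> carrier_mat (2^n) (2^n)" using c by auto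
  moreover have "corr n U ?P (ps n q) = Re (s * hs U (ps n p * U * ps n q)) / 2^n"
    using c by (simp add: corr_def mult_smult_left hs_smult_right[OF c(2) PUQ])
  then have "corr n U ?P (ps n q) = Re s * corr n U (ps n p) (ps n q)" using s(1) by (auto simp: corr_def)
  ultimately show ?thesis using s(1) by auto
qed

text \<open>Pulled back through \<open>C\<close>, the string \<open>ps n p\<close> is not
  \<open>ps n q\<close> up to sign, so by \<open>ps_separated\<close> some \<open>ps n r\<close>
  commutes with one of the two and anticommutes with the other. The pair formed by the image
  \<open>r'\<close> of \<open>r\<close> and by \<open>r\<close> itself then anticommutes with the
  pair \<open>(p,q)\<close>; its own correlation is large by \<open>corr_related\<close>.\<close>

lemma corr_not_related:
  assumes U: "unitary (2^n) U" and C: "C \<in> clifford n" and p: "p < 4^n" and q: "q < 4^n" 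
    and rel: "\<not> related n C p q" and f: "2 * (cmod (hs C U) / 2^n)\<^sup>2 - 1 \<ge> 0"
  shows "(corr n U (ps n p) (ps n q))\<^sup>2 \<le> 1 - (2 * (cmod (hs C U) / 2^n)\<^sup>2 - 1)\<^sup>2"
proof -
  note UC = clifford_unitary[OF C]
  note c = unitary_carrier[OF UC] unitary_carrier[OF U]
  define A where "A = cadj C * ps n p * C"
  have A: "A \<in> carrier_mat (2^n) (2^n)" unfolding A_def using c by auto
  have push: "C * (cadj C * M) = M" "cadj C * (C * M) = M" if "dim_row M = 2^n" for M
  proof -
    have M: "1\<^sub>m (2^n) * M = M" using that by (intro left_mult_one_mat[of M "2^n" "dim_col M"]) auto
    have "C * (cadj C * M) = (C * cadj C) * M" using c that by (intro mat_assoc[symmetric]) auto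
    then show "C * (cadj C * M) = M" by (simp only: unitary_right[OF UC] M)
    have "cadj C * (C * M) = (cadj C * C) * M" using c that by (intro mat_assoc[symmetric]) auto
    then show "cadj C * (C * M) = M" by (simp only: unitary_left[OF UC] M)
  qed
  have "\<exists>r<4^n. \<exists>r'<4^n. related n C r' r \<and> (\<exists>s\<in>{1,-1}. ps n r' * ps n p = s \<cdot>\<^sub>m (ps n p * ps n r')
     \<and> ps n r * ps n q = (- s) \<cdot>\<^sub>m (ps n q * ps n r))"
  proof (rule ccontr)
    assume neg: "\<not> ?thesis"
    have "\<exists>s\<in>{1,-1}. ps n r * A = s \<cdot>\<^sub>m (A * ps n r) \<and> ps n r * ps n q = s \<cdot>\<^sub>m (ps n q * ps n r)"
      if r: "r < 4^n" for r
    proof -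
      obtain r' where r': "r' < 4^n" "related n C r' r" using related_ex[OF C r] by blast
      then obtain u where u: "u \<in> {1,-1}" "C * ps n r * cadj C = u \<cdot>\<^sub>m ps n r'" unfolding related_def by blast
      obtain s where s: "s \<in> {1,-1}" "ps n r' * ps n p = s \<cdot>\<^sub>m (ps n p * ps n r')" using ps_comm by blast
      obtain t where t: "t \<in> {1,-1}" "ps n r * ps n q = t \<cdot>\<^sub>m (ps n q * ps n r)" using ps_comm by blast
      have "t \<noteq> - s" using neg r r' s t by blast
      then have ts: "t = s" using s(1) t(1) by auto
      have "ps n r = cadj C * (C * ps n r * cadj C) * C"
        using c by (simp add: mat_assoc push unitary_left[OF UC] right_mult_one_mat[OF ps_carrier])
      then have R: "ps n r = u \<cdot>\<^sub>m (cadj C * ps n r' * C)"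
        unfolding u(2) using c by (simp add: mult_smult_left mult_smult_right)
      have "ps n r * A = u \<cdot>\<^sub>m (cadj C * (ps n r' * ps n p) * C)"
        unfolding A_def by (subst R) (use c in \<open>simp add: mult_smult_left mat_assoc push\<close>)
      also have "\<dots> = s \<cdot>\<^sub>m (A * ps n r)"
        unfolding A_def s(2) by (subst R) (use c in \<open>simp add: mult_smult_left mult_smult_right mat_assoc push mult.commute\<close>)
      finally show ?thesis using t s ts by blast
    qed
    from ps_separated[OF A q this] obtain k where k: "A = k \<cdot>\<^sub>m ps n q" by blast
    \<comment> \<open>Squaring shows that the scalar \<open>k\<close> is a sign, which would make
      \<open>p\<close> related to \<open>q\<close>.\<close>
    have "A * A = cadj C * (ps n p * ps n p) * C" unfolding A_def using c by (simp add: mat_assoc push)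
    also have "\<dots> = 1\<^sub>m (2^n)" using c by (simp add: ps_square unitary_left[OF UC])
    finally have "(k * k) \<cdot>\<^sub>m 1\<^sub>m (2^n) = (1\<^sub>m (2^n) :: complex mat)"
      unfolding k by (simp add: mult_smult_left mult_smult_right ps_square)
    then have "((k * k) \<cdot>\<^sub>m 1\<^sub>m (2^n)) $$ (0,0) = (1\<^sub>m (2^n) :: complex mat) $$ (0,0)" by simp
    then have kk: "k * k = 1" by simp
    then have k1: "k \<in> {1,-1}" using square_eq_1_iff[of k] by simp
    have "ps n q = k \<cdot>\<^sub>m A" unfolding k by (simp add: kk)
    then have "C * ps n q * cadj C = k \<cdot>\<^sub>m (C * A * cadj C)" using c A by (simp add: mult_smult_left mult_smult_right)
    also have "C * A * cadj C = ps n p"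
      unfolding A_def using c by (simp add: mat_assoc push unitary_right[OF UC] right_mult_one_mat[OF ps_carrier])
    finally show False using rel k1 unfolding related_def by blast
  qed
  then obtain r r' s where r: "r < 4^n" "r' < 4^n" "related n C r' r" and s: "s \<in> {1,-1}"
    "ps n r' * ps n p = s \<cdot>\<^sub>m (ps n p * ps n r')" "ps n r * ps n q = (- s) \<cdot>\<^sub>m (ps n q * ps n r)" by blast
  have ss: "s * s = 1" using s(1) by auto
  have "ps n r' * ps n p * U * ps n q * ps n r = (ps n r' * ps n p) * U * (ps n q * ps n r)"
    using c by (simp add: mat_assoc)
  also have "\<dots> = (-1) \<cdot>\<^sub>m (ps n p * ps n r' * U * ((- s) \<cdot>\<^sub>m (ps n q * ps n r)))"
    unfolding s(2) using c ss s(1) by (auto simp: mult_smult_left mult_smult_right)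
  also have "\<dots> = (-1) \<cdot>\<^sub>m (ps n p * ps n r' * U * ps n r * ps n q)"
    unfolding s(3)[symmetric] using c by (simp add: mat_assoc)
  finally have "(corr n U (ps n r') (ps n r))\<^sup>2 + (corr n U (ps n p) (ps n q))\<^sup>2 \<le> 1"
    by (intro corr_anticommute[OF U]) (auto simp: ps_unitary)
  moreover have "(2 * (cmod (hs C U) / 2^n)\<^sup>2 - 1)\<^sup>2 \<le> \<bar>corr n U (ps n r') (ps n r)\<bar>\<^sup>2"
    by (rule power_mono[OF corr_related[OF U UC r(3)] f])
  ultimately show ?thesis by simp
qed

text \<open>\<open>A = cadj C' * C\<close> commutes with every string up to a sign. A string
  \<open>ps n r\<close> on which \<open>A\<close> has a nonzero coefficient must show the same signs
  as \<open>A\<close>, so \<open>ps_separated\<close> makes \<open>A\<close> a multiple of it, and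
  unitarity makes the factor a phase.\<close>

lemma clifford_coset:
  assumes C: "unitary (2^n) C" and C': "unitary (2^n) C'"
    and rel: "\<And>q. q < 4^n \<Longrightarrow> \<exists>p. related n C p q \<and> related n C' p q"
  shows "\<exists>r<4^n. \<exists>c. cmod c = 1 \<and> C = c \<cdot>\<^sub>m (C' * ps n r)"
proof -
  note c = unitary_carrier[OF C] unitary_carrier[OF C']
  define A where "A = cadj C' * C"
  have UA: "unitary (2^n) A" unfolding A_def by (intro unitary_mult unitary_cadj C C')
  note a = unitary_carrier[OF UA]
  have CA: "C = C' * A"
    using c left_mult_one_mat[OF c(1)] by (simp add: A_def unitary_right[OF C'] flip: mat_assoc)
  have comm: "\<exists>s\<in>{1,-1}. ps n q * A = s \<cdot>\<^sub>m (A * ps n q)" if q: "q < 4^n" for q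
  proof -
    obtain p s t where st: "s \<in> {1,-1}" "C * ps n q * cadj C = s \<cdot>\<^sub>m ps n p"
      "t \<in> {1,-1}" "C' * ps n q * cadj C' = t \<cdot>\<^sub>m ps n p" using rel[OF q] unfolding related_def by blast
    have tt: "t * t = 1" using st by auto
    have "ps n q * A = cadj C' * (C' * ps n q * cadj C') * C"
    proof -
      have "cadj C' * (C' * ps n q * cadj C') * C = (cadj C' * C') * (ps n q * (cadj C' * C))"
        using c by (simp add: mat_assoc)
      also have "\<dots> = ps n q * A" using a by (simp add: unitary_left[OF C'] flip: A_def)
      finally show ?thesis ..
    qed
    also have "\<dots> = (s * t) \<cdot>\<^sub>m (cadj C' * (s \<cdot>\<^sub>m ps n p) * C)"
      unfolding st(4) using c st(1,3) by (auto simp: mult_smult_left mult_smult_right)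
    also have "cadj C' * (s \<cdot>\<^sub>m ps n p) * C = A * ps n q"
    proof -
      have "cadj C' * (C * ps n q * cadj C) * C = (cadj C' * C) * ps n q * (cadj C * C)"
        using c by (simp add: mat_assoc)
      also have "\<dots> = A * ps n q"
        using a right_mult_one_mat[OF mult_carrier_mat[OF a ps_carrier]] by (simp add: unitary_left[OF C] flip: A_def)
      finally show ?thesis unfolding st(2) .
    qed
    finally show ?thesis using sign_mult[OF st(1,3)] by blast
  qed
  have "\<exists>r<4^n. hs (ps n r) A \<noteq> 0"
  proof (rule ccontr)
    assume "\<not> ?thesis"
    then have "(\<Sum>r<4^n. cnj (hs (ps n r) A) * hs (ps n r) A) = 0" by (intro sum.neutral) auto
    then show False using ps_parseval[OF a a] hs_self_unitary[OF UA] by simp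
  qed
  then obtain r where r: "r < 4^n" "hs (ps n r) A \<noteq> 0" by blast
  have "\<exists>s\<in>{1,-1}. ps n q * A = s \<cdot>\<^sub>m (A * ps n q) \<and> ps n q * ps n r = s \<cdot>\<^sub>m (ps n r * ps n q)"
    if q: "q < 4^n" for q
  proof -
    obtain s where s: "s \<in> {1,-1}" "ps n q * A = s \<cdot>\<^sub>m (A * ps n q)" using comm[OF q] by blast
    obtain t where t: "t \<in> {1,-1}" "ps n q * ps n r = t \<cdot>\<^sub>m (ps n r * ps n q)" using ps_comm by blast
    have AR: "A * ps n q \<in> carrier_mat (2^n) (2^n)" "ps n r * ps n q \<in> carrier_mat (2^n) (2^n)" using a by auto
    \<comment> \<open>Multiplying by \<open>ps n q\<close> on the left and undoing it on the right
      leaves the nonzero coefficient unchanged except for the product of the two signs, which is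
      therefore 1.\<close>
    have "hs (ps n r) A = hs (ps n q * ps n r) (ps n q * A)"
      by (rule hs_unitary_left[symmetric, OF ps_unitary ps_carrier a])
    also have "\<dots> = cnj t * s * hs (ps n r * ps n q) (A * ps n q)"
      unfolding s(2) t(2) hs_smult_left hs_smult_right[OF AR(2,1)] by simp
    also have "hs (ps n r * ps n q) (A * ps n q) = hs (ps n r) A"
      by (rule hs_unitary_right[OF ps_unitary ps_carrier a])
    finally have "cnj t * s = 1" using r(2) by simp
    then have "t = s" using s(1) t(1) by auto
    then show ?thesis using s t by blast
  qed
  from ps_separated[OF a r(1) this] obtain k where k: "A = k \<cdot>\<^sub>m ps n r" by blast
  have "hs A A = k * cnj k * hs (ps n r) (ps n r)"
    unfolding k by (simp add: hs_smult_left hs_smult_right[OF ps_carrier ps_carrier])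
  then have "k * cnj k = 1" by (simp add: hs_self_unitary[OF UA] hs_ps r(1))
  then have "cmod k = 1" by (metis complex_mod_mult_cnj norm_one power2_eq_1_iff norm_ge_zero one_neq_neg_one le_minus_one_simps(3) norm_minus_cancel)
  moreover have "C = k \<cdot>\<^sub>m (C' * ps n r)" using CA c unfolding k by (simp add: mult_smult_right)
  ultimately show ?thesis using r(1) by blast
qed

section \<open>Choi states\<close>

text \<open>The maximally entangled state after \<open>U\<close> on its first half: the quotient of
  the index by \<open>2^n\<close> is the output register, the remainder is the input
  register.\<close>

definition choi :: "nat \<Rightarrow> complex mat \<Rightarrow> complex mat" where
  "choi n U = mat (4^n) 1 (\<lambda>(y,_). U $$ (y div 2^n, y mod 2^n) / complex_of_real (sqrt (2^n)))"

lemma choi_carrier [simp, intro]: "choi n U \<in> carrier_mat (4^n) 1"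
  by (simp add: choi_def)

lemma choi_entry: "i < 2^n \<Longrightarrow> j < 2^n \<Longrightarrow> choi n U $$ (i*2^n+j, 0) = U $$ (i,j) / complex_of_real (sqrt (2^n))"
  using add_lt_mult[of i "2^n" j "2^n"] by (simp add: choi_def four_pow)

lemma choi_norm:
  assumes U: "unitary (2^n) U"
  shows "(\<Sum>y<4^n. (cmod (choi n U $$ (y,0)))\<^sup>2) = 1"
proof -
  have "(\<Sum>y<4^n. (cmod (choi n U $$ (y,0)))\<^sup>2) = (\<Sum>i<2^n. \<Sum>j<2^n. (cmod (U $$ (i,j)))\<^sup>2) / 2^n"
    unfolding four_pow sum_lessThan_mult sum_divide_distrib
    by (intro sum.cong refl) (simp add: choi_entry norm_divide power_divide)
  also have "complex_of_real (\<Sum>i<2^n. \<Sum>j<2^n. (cmod (U $$ (i,j)))\<^sup>2) = complex_of_real (2^n)"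
    using hs_self_unitary[OF U] unitary_carrier[OF U] unfolding hs_self by simp
  then have "(\<Sum>i<2^n. \<Sum>j<2^n. (cmod (U $$ (i,j)))\<^sup>2) = 2^n" by (simp only: of_real_eq_iff)
  finally show ?thesis by simp
qed

lemma pbasis_choi:
  assumes C: "C \<in> carrier_mat (2^n) (2^n)" and s: "s < 4^n"
  shows "(pbasis n C * choi n U) $$ (s,0) = hs (C * ps n s) U / 2^n"
proof -
  have cr: "C * ps n s \<in> carrier_mat (2^n) (2^n)" using C by auto
  have "(pbasis n C * choi n U) $$ (s,0) = (\<Sum>y<4^n. pbasis n C $$ (s,y) * choi n U $$ (y,0))"
    by (rule mult_entry[OF pbasis_carrier choi_carrier s]) simp
  also have "\<dots> = (\<Sum>i<2^n. \<Sum>j<2^n. cnj ((C * ps n s) $$ (i,j)) * U $$ (i,j) / 2^n)"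
    unfolding four_pow sum_lessThan_mult
    using s by (intro sum.cong refl)
      (simp add: pbasis_entry choi_entry sqrt_2n del: index_mult_mat flip: of_real_mult)
  also have "\<dots> = hs (C * ps n s) U / 2^n"
    by (simp add: hs_alt[OF cr] sum_divide_distrib)
  finally show ?thesis .
qed

section \<open>Bell sampling of two Choi states\<close>

text \<open>Bell measurement on two copies of a Choi state, separately on the two output registers and on
  the two input registers.\<close>

definition bell :: "nat \<Rightarrow> complex mat" where
  "bell n = mat (4^n*4^n) (4^n*4^n) (\<lambda>(x,y).
     cnj (ps n (x div 4^n) $$ (y div 4^n div 2^n, y mod 4^n div 2^n))
       * ps n (x mod 4^n) $$ (y div 4^n mod 2^n, y mod 4^n mod 2^n) / 2^n)"

lemma bell_carrier [simp, intro]: "bell n \<in> carrier_mat (4^n*4^n) (4^n*4^n)"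
  by (simp add: bell_def)

lemma bell_entry:
  assumes "x < 4^n*4^n" "i < 2^n" "j < 2^n" "k < 2^n" "l < 2^n"
  shows "bell n $$ (x, (i*2^n+j)*4^n + (k*2^n+l))
     = cnj (ps n (x div 4^n) $$ (i,k)) * ps n (x mod 4^n) $$ (j,l) / 2^n"
proof -
  have lt: "i*2^n+j < 4^n" "k*2^n+l < (4^n::nat)" using assms by (auto simp: four_pow add_lt_mult)
  from lt have "(i*2^n+j)*4^n + (k*2^n+l) < 4^n * (4^n::nat)" by (rule add_lt_mult)
  moreover have "((i*2^n+j)*4^n + (k*2^n+l)) div 4^n = i*2^n+j" "((i*2^n+j)*4^n + (k*2^n+l)) mod 4^n = k*2^n+l"
    using lt by auto
  ultimately show ?thesis using assms by (simp add: bell_def)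
qed

lemma sum_pairs:
  fixes f :: "nat \<Rightarrow> 'a::comm_monoid_add"
  shows "(\<Sum>y<4^n*4^n. f y)
    = (\<Sum>i<2^n. \<Sum>j<2^n. \<Sum>k<2^n. \<Sum>l<2^n. f ((i*2^n+j)*4^n + (k*2^n+l)))"
proof -
  have "(\<Sum>y<4^n*4^n. f y) = (\<Sum>a<4^n. \<Sum>b<4^n. f (a*4^n+b))" by (rule sum_lessThan_mult)
  also have "\<dots> = (\<Sum>a<2^n*2^n. \<Sum>b<2^n*2^n. f (a*4^n+b))" by (simp only: four_pow)
  finally show ?thesis unfolding sum_lessThan_mult .
qed

lemma bell_unitary: "unitary (4^n*4^n) (bell n)"
proof (rule unitaryI)
  fix x y :: nat assume xy: "x < 4^n*4^n" "y < 4^n*4^n"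
  let ?R = "\<lambda>z. ps n (z div 4^n)" and ?S = "\<lambda>z. ps n (z mod 4^n)"
  have "(\<Sum>z<4^n*4^n. bell n $$ (x,z) * cnj (bell n $$ (y,z)))
     = (\<Sum>i<2^n. \<Sum>j<2^n. \<Sum>k<2^n. \<Sum>l<2^n.
         (cnj (?R x $$ (i,k)) * ?R y $$ (i,k)) * (cnj (?S y $$ (j,l)) * ?S x $$ (j,l)) / (2^n * 2^n))"
    unfolding sum_pairs using xy by (intro sum.cong refl) (simp add: bell_entry)
  also have "\<dots> = (\<Sum>i<2^n. \<Sum>k<2^n. \<Sum>j<2^n. \<Sum>l<2^n.
         (cnj (?R x $$ (i,k)) * ?R y $$ (i,k)) * (cnj (?S y $$ (j,l)) * ?S x $$ (j,l)) / (2^n * 2^n))"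
    by (intro sum.cong refl sum.swap)
  also have "\<dots> = hs (?R x) (?R y) * hs (?S y) (?S x) / (2^n * 2^n)"
    unfolding hs_alt[OF ps_carrier] 
    by (simp only: sum_distrib_right sum_divide_distrib, simp only: sum_distrib_left sum_divide_distrib)
  also have "\<dots> = (if x = y then 1 else 0)"
    using divmod_eq_iff[of x y "4^n"] div_lt_mult[OF xy(1)] div_lt_mult[OF xy(2)] mod_lt_mult[OF xy(1)] mod_lt_mult[OF xy(2)]
    by (auto simp: hs_ps)
  finally show "(\<Sum>z<4^n*4^n. bell n $$ (x,z) * cnj (bell n $$ (y,z))) = (if x = y then 1 else 0)" .
qed auto

text \<open>Only the output factor of \<open>bell\<close> is conjugated. The input factor therefore
  links the two copies of \<open>U\<close> into one matrix product, with a transpose since the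
  second copy is traversed backwards.\<close>

lemma bell_choi:
  assumes U: "U \<in> carrier_mat (2^n) (2^n)" and x: "x < 4^n*4^n"
  shows "(bell n * kron (choi n U) (choi n U)) $$ (x,0)
    = hs (ps n (x div 4^n)) (U * ps n (x mod 4^n) * transpose_mat U) / (2^n * 2^n)"
proof -
  let ?R = "ps n (x div 4^n)" and ?S = "ps n (x mod 4^n)"
  let ?v = "kron (choi n U) (choi n U)"
  have v: "?v \<in> carrier_mat (4^n*4^n) 1" using kron_carrier[OF choi_carrier choi_carrier, of n U n U] by simp
  have lt: "i*2^n+j < (4^n::nat)" if "i < 2^n" "j < 2^n" for i j using that by (auto simp: four_pow add_lt_mult)
  have ve: "?v $$ ((i*2^n+j)*4^n + (k*2^n+l), 0) = U $$ (i,j) * U $$ (k,l) / 2^n"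
    if "i < 2^n" "j < 2^n" "k < 2^n" "l < 2^n" for i j k l
    using kron_entry'[OF choi_carrier choi_carrier lt[OF that(1,2)] lt[OF that(3,4)], of 0 0 U U] that
    by (simp add: choi_entry sqrt_2n flip: of_real_mult)
  have "(bell n * ?v) $$ (x,0) = (\<Sum>y<4^n*4^n. bell n $$ (x,y) * ?v $$ (y,0))"
    by (rule mult_entry[OF bell_carrier v x]) simp
  also have "\<dots> = (\<Sum>i<2^n. \<Sum>j<2^n. \<Sum>k<2^n. \<Sum>l<2^n.
      cnj (?R $$ (i,k)) * (U $$ (i,j) * ?S $$ (j,l) * U $$ (k,l)) / (2^n * 2^n))"
    unfolding sum_pairs using x by (intro sum.cong refl) (simp add: bell_entry ve)
  also have "\<dots> = (\<Sum>i<2^n. \<Sum>k<2^n. \<Sum>j<2^n. \<Sum>l<2^n.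
      cnj (?R $$ (i,k)) * (U $$ (i,j) * ?S $$ (j,l) * U $$ (k,l)) / (2^n * 2^n))"
    by (intro sum.cong refl sum.swap)
  also have "\<dots> = (\<Sum>i<2^n. \<Sum>k<2^n. \<Sum>l<2^n. \<Sum>j<2^n.
      cnj (?R $$ (i,k)) * (U $$ (i,j) * ?S $$ (j,l) * U $$ (k,l)) / (2^n * 2^n))"
    by (intro sum.cong refl sum.swap)
  also have "\<dots> = (\<Sum>i<2^n. \<Sum>k<2^n. cnj (?R $$ (i,k)) * (U * ?S * transpose_mat U) $$ (i,k) / (2^n * 2^n))"
  proof (intro sum.cong refl)
    fix i k :: nat assume "i \<in> {..<2^n}" "k \<in> {..<2^n}"
    then have ik: "i < 2^n" "k < 2^n" by auto
    have "(U * ?S * transpose_mat U) $$ (i,k) = (\<Sum>l<2^n. (U * ?S) $$ (i,l) * transpose_mat U $$ (l,k))"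
      by (rule mult_entry[OF mult_carrier_mat[OF U ps_carrier] _ ik]) (use U in auto)
    also have "\<dots> = (\<Sum>l<2^n. \<Sum>j<2^n. U $$ (i,j) * ?S $$ (j,l) * U $$ (k,l))"
      using ik U by (intro sum.cong refl) (simp add: mult_entry[OF U ps_carrier] sum_distrib_right del: index_mult_mat(1))
    finally show "(\<Sum>l<2^n. \<Sum>j<2^n. cnj (?R $$ (i,k)) * (U $$ (i,j) * ?S $$ (j,l) * U $$ (k,l)) / (2^n * 2^n))
      = cnj (?R $$ (i,k)) * (U * ?S * transpose_mat U) $$ (i,k) / (2^n * 2^n)"
      by (simp only: sum_distrib_left sum_divide_distrib)
  qed
  also have "\<dots> = hs ?R (U * ?S * transpose_mat U) / (2^n * 2^n)"
    by (simp add: hs_alt[OF ps_carrier] sum_divide_distrib)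
  finally show ?thesis .
qed

text \<open>The vectorisation of \<open>ps n r\<close> is an eigenvector of the tensor square of
  \<open>ps n p\<close>; this is the eigenvalue, so \<open>psign\<close> gives the value of that
  observable when the Bell outcome is \<open>r\<close>.\<close>

definition psign :: "nat \<Rightarrow> nat \<Rightarrow> nat \<Rightarrow> real" where
  "psign n p r = (if ps n p * ps n r * transpose_mat (ps n p) = ps n r then 1 else - 1)"

lemma psign_eq: "ps n p * ps n r * transpose_mat (ps n p) = complex_of_real (psign n p r) \<cdot>\<^sub>m ps n r"
  using ps_conj_transpose[of n p r] by (auto simp: psign_def)

lemma psign_cases: "psign n p r = 1 \<or> psign n p r = -1"
  by (simp add: psign_def)

text \<open>The left side is \<open>2^n\<close> times the trace, in the orthogonal basis of strings,
  of the linear map sending \<open>S\<close> to \<open>X * S * transpose_mat X\<close>. That map is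
  \<open>kron X X\<close> on vectorised matrices, so its trace is the square of the trace of
  \<open>X\<close>.\<close>

lemma sum_ps_conj:
  assumes X: "X \<in> carrier_mat (2^n) (2^n)"
  shows "(\<Sum>s<4^n. hs (ps n s) (X * ps n s * transpose_mat X)) = 2^n * (hs (1\<^sub>m (2^n)) X)\<^sup>2"
proof -
  let ?d = "2^n :: nat"
  have z: "(if P then a else 0) * b = (if P then a * b else 0)" for P and a b :: complex by simp
  have "hs (ps n s) (X * ps n s * transpose_mat X)
     = (\<Sum>i<?d. \<Sum>j<?d. \<Sum>l<?d. \<Sum>k<?d. (cnj (ps n s $$ (i,j)) * ps n s $$ (k,l)) * (X $$ (i,k) * X $$ (j,l)))" for s
    unfolding hs_alt[OF ps_carrier]
  proof (intro sum.cong refl)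
    fix i j assume "i \<in> {..<?d}" "j \<in> {..<?d}"
    then have ij: "i < ?d" "j < ?d" by auto
    have "(X * ps n s * transpose_mat X) $$ (i,j) = (\<Sum>l<?d. (X * ps n s) $$ (i,l) * transpose_mat X $$ (l,j))"
      by (rule mult_entry[OF mult_carrier_mat[OF X ps_carrier] _ ij]) (use X in auto)
    also have "\<dots> = (\<Sum>l<?d. \<Sum>k<?d. X $$ (i,k) * ps n s $$ (k,l) * X $$ (j,l))"
      using ij X by (intro sum.cong refl) (simp add: mult_entry[OF X ps_carrier] sum_distrib_right del: index_mult_mat(1))
    finally show "cnj (ps n s $$ (i,j)) * (X * ps n s * transpose_mat X) $$ (i,j)
      = (\<Sum>l<?d. \<Sum>k<?d. (cnj (ps n s $$ (i,j)) * ps n s $$ (k,l)) * (X $$ (i,k) * X $$ (j,l)))"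
      by (simp add: sum_distrib_left mult_ac del: index_mult_mat)
  qed
  then have "(\<Sum>s<4^n. hs (ps n s) (X * ps n s * transpose_mat X))
    = (\<Sum>s<4^n. \<Sum>i<?d. \<Sum>j<?d. \<Sum>l<?d. \<Sum>k<?d. (cnj (ps n s $$ (i,j)) * ps n s $$ (k,l)) * (X $$ (i,k) * X $$ (j,l)))"
    by simp
  also have "\<dots> = (\<Sum>i<?d. \<Sum>s<4^n. \<Sum>j<?d. \<Sum>l<?d. \<Sum>k<?d. (cnj (ps n s $$ (i,j)) * ps n s $$ (k,l)) * (X $$ (i,k) * X $$ (j,l)))"
    by (rule sum.swap)
  also have "\<dots> = (\<Sum>i<?d. \<Sum>j<?d. \<Sum>s<4^n. \<Sum>l<?d. \<Sum>k<?d. (cnj (ps n s $$ (i,j)) * ps n s $$ (k,l)) * (X $$ (i,k) * X $$ (j,l)))"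
    by (intro sum.cong refl sum.swap)
  also have "\<dots> = (\<Sum>i<?d. \<Sum>j<?d. \<Sum>l<?d. \<Sum>s<4^n. \<Sum>k<?d. (cnj (ps n s $$ (i,j)) * ps n s $$ (k,l)) * (X $$ (i,k) * X $$ (j,l)))"
    by (intro sum.cong refl sum.swap)
  also have "\<dots> = (\<Sum>i<?d. \<Sum>j<?d. \<Sum>l<?d. \<Sum>k<?d. \<Sum>s<4^n. (cnj (ps n s $$ (i,j)) * ps n s $$ (k,l)) * (X $$ (i,k) * X $$ (j,l)))"
    by (intro sum.cong refl sum.swap)
  also have "\<dots> = (\<Sum>i<?d. \<Sum>j<?d. \<Sum>l<?d.
         if l = j then (\<Sum>k<?d. if k = i then 2^n * (X $$ (i,k) * X $$ (j,l)) else 0) else 0)"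
    by (intro sum.cong refl)
      (auto simp: ps_complete z simp flip: sum_distrib_right)
  also have "\<dots> = (\<Sum>i<?d. \<Sum>j<?d. 2^n * (X $$ (i,i) * X $$ (j,j)))"
    by (intro sum.cong refl) simp
  also have "\<dots> = 2^n * (hs (1\<^sub>m ?d) X)\<^sup>2"
    unfolding hs_one[OF X] power2_eq_square sum_product by (simp only: sum_distrib_left)
  finally show ?thesis .
qed

text \<open>The signs are the values of
  \<open>(P \<otimes> Q\<^sup>T) \<otimes> (P \<otimes> Q\<^sup>T)\<close> at the Bell outcome, and
  in a product of two equal states the expectation is the square of that in a single one. The proof
  carries this out by removing the sum over output outcomes and then the one over input
  outcomes.\<close>

lemma bell_mean:
  assumes U: "unitary (2^n) U"
  shows "(\<Sum>x<4^n*4^n. psign n p (x div 4^n) * psign n q (x mod 4^n)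
      * (cmod ((bell n * kron (choi n U) (choi n U)) $$ (x,0)))\<^sup>2) = (corr n U (ps n p) (ps n q))\<^sup>2"
proof -
  let ?d = "2^n :: nat"
  note c = unitary_carrier[OF U]
  let ?P = "ps n p" and ?Q = "ps n q"
  let ?T = transpose_mat
  define M where "M s = U * ps n s * ?T U" for s
  have tU: "?T U \<in> carrier_mat ?d ?d" using c by simp
  have M: "M s \<in> carrier_mat ?d ?d" for s unfolding M_def using c by auto
  have cT: "cadj (?T A) = ?T (cadj A)" for A by (rule eq_matI) (auto simp: cadj_def)
  define X where "X = cadj U * ?P * U * ?Q"
  have X: "X \<in> carrier_mat ?d ?d" unfolding X_def using c by auto
  have XT: "?T X = ?T ?Q * ?T U * ?T ?P * ?T (cadj U)"
    unfolding X_def using c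
    by (simp add: transpose_mult_dim mat_assoc)
  \<comment> \<open>Sign times coefficient is a coefficient of \<open>?P * M s * ?T ?P\<close>, so
    Parseval sums over \<open>r\<close>.\<close>
  have step1: "(\<Sum>r<4^n. complex_of_real (psign n p r) * complex_of_real ((cmod (hs (ps n r) (M s)))\<^sup>2))
      = 2^n * hs (M s) (?P * M s * ?T ?P)" for s
  proof -
    have PM: "?P * M s * ?T ?P \<in> carrier_mat ?d ?d" using M[of s] by auto
    have "complex_of_real (psign n p r) * complex_of_real ((cmod (hs (ps n r) (M s)))\<^sup>2)
       = cnj (hs (ps n r) (M s)) * hs (ps n r) (?P * M s * ?T ?P)" for r
    proof -
      have "hs (ps n r) (?P * M s * ?T ?P) = hs (?P * ps n r * ?T ?P) (M s)"
      proof -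
        have "hs (?P * ps n r * ?T ?P) (M s) = hs (?P * ps n r) (M s * ?T ?P)"
          using hs_right_mult[of "?P * ps n r" ?d ?d "?T ?P" ?d "M s"] M[of s]
            mult_carrier_mat[OF ps_carrier[of n p] ps_carrier[of n r]] by (simp add: cT)
        also have "\<dots> = hs (ps n r) (?P * (M s * ?T ?P))"
          using hs_left_mult[of ?P ?d ?d "ps n r" ?d "M s * ?T ?P"] M[of s] by simp
        finally show ?thesis using M[of s] by (simp add: mat_assoc)
      qed
      also have "\<dots> = complex_of_real (psign n p r) * hs (ps n r) (M s)"
        unfolding psign_eq hs_smult_left by simp
      finally show ?thesis by (simp add: complex_norm_square mult_ac del: of_real_power)
    qed
    then show ?thesis using ps_parseval[OF M PM] by simp
  qed
  \<comment> \<open>The other sign is absorbed by conjugating \<open>ps n s\<close> with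
    \<open>?Q\<close>; moving all factors to one side of \<open>hs\<close> leaves the map of
    \<open>sum_ps_conj\<close>, for an \<open>X\<close> whose trace is the correlation up to
    normalisation.\<close>
  have step2: "complex_of_real (psign n q s) * hs (M s) (?P * M s * ?T ?P) = hs (ps n s) (X * ps n s * ?T X)" for s
  proof -
    have "complex_of_real (psign n q s) * hs (M s) (?P * M s * ?T ?P)
       = hs (M s) (?P * (U * (complex_of_real (psign n q s) \<cdot>\<^sub>m ps n s) * ?T U) * ?T ?P)"
    proof -
      have "?P * (U * (complex_of_real (psign n q s) \<cdot>\<^sub>m ps n s) * ?T U) * ?T ?P
        = complex_of_real (psign n q s) \<cdot>\<^sub>m (?P * M s * ?T ?P)"
        using c by (simp add: M_def mult_smult_left mult_smult_right)
      moreover have "?P * M s * ?T ?P \<in> carrier_mat ?d ?d" using M[of s] by auto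
      ultimately show ?thesis using hs_smult_right[OF M[of s], of "?P * M s * ?T ?P"] by simp
    qed
    also have "\<dots> = hs (U * ps n s * ?T U) (?P * U * ?Q * ps n s * ?T ?Q * ?T U * ?T ?P)"
      unfolding psign_eq[symmetric] M_def using c by (simp add: mat_assoc)
    also have "\<dots> = hs (U * ps n s) (?P * U * ?Q * ps n s * ?T ?Q * ?T U * ?T ?P * ?T (cadj U))"
      using c by (subst hs_right_mult[of _ ?d ?d _ ?d]) (auto simp: cT)
    also have "\<dots> = hs (ps n s) (cadj U * (?P * U * ?Q * ps n s * ?T ?Q * ?T U * ?T ?P * ?T (cadj U)))"
      using c by (subst hs_left_mult[of _ ?d ?d _ ?d]) auto
    also have "cadj U * (?P * U * ?Q * ps n s * ?T ?Q * ?T U * ?T ?P * ?T (cadj U)) = X * ps n s * ?T X"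
      unfolding XT unfolding X_def using c by (simp add: mat_assoc)
    finally show ?thesis .
  qed
  have trX: "hs (1\<^sub>m ?d) X = 2^n * complex_of_real (corr n U ?P ?Q)"
  proof -
    have "hs (1\<^sub>m ?d) X = hs (U * 1\<^sub>m ?d) (?P * U * ?Q)"
      using c hs_left_mult[OF c one_carrier_mat mult_carrier_mat[OF mult_carrier_mat[OF ps_carrier[of n p] c] ps_carrier[of n q]]]
      by (simp add: X_def mat_assoc)
    then show ?thesis using c hs_corr[OF c ps_carrier ps_cadj ps_carrier ps_cadj, of p q] by simp
  qed
  have "complex_of_real (\<Sum>x<4^n*4^n. psign n p (x div 4^n) * psign n q (x mod 4^n)
      * (cmod ((bell n * kron (choi n U) (choi n U)) $$ (x,0)))\<^sup>2)
    = (\<Sum>r<4^n. \<Sum>s<4^n. complex_of_real (psign n q s) / (2^n * 2^n)\<^sup>2 *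
        (complex_of_real (psign n p r) * complex_of_real ((cmod (hs (ps n r) (M s)))\<^sup>2)))"
    unfolding sum_lessThan_mult of_real_sum
    by (intro sum.cong refl)
      (simp add: bell_choi[OF c] add_lt_mult M_def norm_divide norm_mult norm_power power_divide del: index_mult_mat)
  also have "\<dots> = (\<Sum>s<4^n. \<Sum>r<4^n. complex_of_real (psign n q s) / (2^n * 2^n)\<^sup>2 *
        (complex_of_real (psign n p r) * complex_of_real ((cmod (hs (ps n r) (M s)))\<^sup>2)))"
    by (rule sum.swap)
  also have "\<dots> = (\<Sum>s<4^n. 2^n / (2^n * 2^n)\<^sup>2 * (complex_of_real (psign n q s) * hs (M s) (?P * M s * ?T ?P)))"
    unfolding sum_distrib_left[symmetric] step1 by (simp add: sum_distrib_left sum_divide_distrib mult_ac)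
  also have "\<dots> = 2^n / (2^n * 2^n)\<^sup>2 * (2^n * (hs (1\<^sub>m ?d) X)\<^sup>2)"
    unfolding step2 sum_distrib_left[symmetric] sum_ps_conj[OF X] ..
  also have "\<dots> = complex_of_real ((corr n U ?P ?Q)\<^sup>2)"
    unfolding trX by (simp add: power2_eq_square)
  finally show ?thesis by (simp only: of_real_eq_iff)
qed

section \<open>Circuits\<close>

text \<open>Exchanges a leading register of dimension \<open>a\<close> with the rest. Since only the
  leading qubits reach the oracle, this rotates the next copy into place.\<close>

definition swap_mat :: "nat \<Rightarrow> nat \<Rightarrow> complex mat" where
  "swap_mat a b = mat (a*b) (a*b) (\<lambda>(x,y). if y = (x mod a) * b + x div a then 1 else 0)"

lemma swap_mat_carrier [simp, intro]: "swap_mat a b \<in> carrier_mat (a*b) (a*b)"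
  by (simp add: swap_mat_def)

lemma swap_index_lt: "x < a * b \<Longrightarrow> (x mod a) * b + x div a < a * (b::nat)"
  using add_lt_mult[OF mod_lt_mult[of x b a] div_lt_mult[of x b a]] by (simp add: mult.commute)

lemma swap_mat_unitary: "unitary (a*b) (swap_mat a b)"
proof (rule unitaryI)
  fix x y assume xy: "x < a*b" "y < a*b"
  let ?f = "\<lambda>x. (x mod a) * b + x div a"
  have d: "x div a < b" "y div a < b" using xy by (auto intro!: div_lt_mult simp: mult.commute)
  have "(\<Sum>k<a*b. swap_mat a b $$ (x,k) * cnj (swap_mat a b $$ (y,k)))
    = (\<Sum>k<a*b. if k = ?f x then (if ?f x = ?f y then 1 else 0) else 0)"
    using xy by (intro sum.cong refl) (auto simp: swap_mat_def)
  also have "\<dots> = (if ?f x = ?f y then 1 else 0)" using swap_index_lt[OF xy(1)] by simp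
  also have "?f x = ?f y \<longleftrightarrow> x = y"
    using divmod_eq_iff[of "?f x" "?f y" b] divmod_eq_iff[of x y a] d by auto
  finally show "(\<Sum>k<a*b. swap_mat a b $$ (x,k) * cnj (swap_mat a b $$ (y,k))) = (if x = y then 1 else 0)" .
qed auto

lemma swap_mat_kron:
  assumes A: "A \<in> carrier_mat a 1" and B: "B \<in> carrier_mat b 1"
  shows "swap_mat a b * kron A B = kron B A"
proof (rule eq_matI)
  fix x y assume "x < dim_row (kron B A)" "y < dim_col (kron B A)"
  then have x: "x < a * b" "y = 0" using A B by (auto simp: kron_def mult.commute)
  have d: "x div a < b" using x by (auto intro!: div_lt_mult simp: mult.commute)
  have k: "kron A B \<in> carrier_mat (a*b) 1" using kron_carrier[OF A B] by simp
  have "(swap_mat a b * kron A B) $$ (x,y) = (\<Sum>k<a*b. swap_mat a b $$ (x,k) * kron A B $$ (k,0))"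
    unfolding x(2) by (rule mult_entry[OF swap_mat_carrier k x(1)]) simp
  also have "\<dots> = (\<Sum>k<a*b. if k = (x mod a) * b + x div a then kron A B $$ (k,0) else 0)"
    using x by (intro sum.cong refl) (auto simp: swap_mat_def)
  also have "\<dots> = kron A B $$ ((x mod a) * b + x div a, 0)" using swap_index_lt[OF x(1)] by simp
  also have "\<dots> = kron B A $$ (x,y)"
    using x d swap_index_lt[OF x(1)] by (simp add: kron_entry[OF A B] kron_entry[OF B A] mult.commute)
  finally show "(swap_mat a b * kron A B) $$ (x,y) = kron B A $$ (x,y)" .
qed (use A B in \<open>auto simp: swap_mat_def kron_def\<close>)

text \<open>Deferred measurement: \<open>A\<close> acts on the first register, then
  \<open>B i\<close> on the second if the first is in state \<open>i\<close>. The outcome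
  \<open>i\<close> fixes the second basis although both registers are read at the end.\<close>

definition controlled :: "nat \<Rightarrow> nat \<Rightarrow> complex mat \<Rightarrow> (nat \<Rightarrow> complex mat) \<Rightarrow> complex mat" where
  "controlled a b A B = mat (a*b) (a*b) (\<lambda>(x,y). A $$ (x div b, y div b) * B (x div b) $$ (x mod b, y mod b))"

lemma controlled_carrier [simp, intro]: "controlled a b A B \<in> carrier_mat (a*b) (a*b)"
  by (simp add: controlled_def)

lemma controlled_unitary:
  assumes A: "unitary a A" and B: "\<And>i. unitary b (B i)"
  shows "unitary (a*b) (controlled a b A B)"
proof (rule unitaryI)
  fix x y assume xy: "x < a*b" "y < a*b"
  have "(\<Sum>k<a*b. controlled a b A B $$ (x,k) * cnj (controlled a b A B $$ (y,k)))
    = (\<Sum>i<a. \<Sum>j<b. (A $$ (x div b, i) * cnj (A $$ (y div b, i)))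
        * (B (x div b) $$ (x mod b, j) * cnj (B (y div b) $$ (y mod b, j))))"
    unfolding sum_lessThan_mult using xy by (intro sum.cong refl) (simp add: controlled_def add_lt_mult)
  also have "\<dots> = (\<Sum>i<a. A $$ (x div b, i) * cnj (A $$ (y div b, i)))
     * (\<Sum>j<b. B (x div b) $$ (x mod b, j) * cnj (B (y div b) $$ (y mod b, j)))"
    by (simp only: sum_product)
  also have "\<dots> = (if x = y then 1 else 0)"
    using div_lt_mult[OF xy(1)] div_lt_mult[OF xy(2)] mod_lt_mult[OF xy(1)] mod_lt_mult[OF xy(2)]
      divmod_eq_iff[of x y b]
    by (auto simp: unitaryD[OF A] unitaryD[OF B])
  finally show "(\<Sum>k<a*b. controlled a b A B $$ (x,k) * cnj (controlled a b A B $$ (y,k))) = (if x = y then 1 else 0)" .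
qed auto

lemma controlled_kron:
  assumes A: "A \<in> carrier_mat a a" and B: "\<And>i. B i \<in> carrier_mat b b"
    and v: "v \<in> carrier_mat a 1" and w: "w \<in> carrier_mat b 1" and x: "x < a*b"
  shows "(controlled a b A B * kron v w) $$ (x,0) = (A * v) $$ (x div b, 0) * (B (x div b) * w) $$ (x mod b, 0)"
proof -
  have k: "kron v w \<in> carrier_mat (a*b) 1" using kron_carrier[OF v w] by simp
  have e: "kron v w $$ (i*b+j,0) = v $$ (i,0) * w $$ (j,0)" if "i < a" "j < b" for i j
    using kron_entry'[OF v w that, of 0 0] by simp
  have "(controlled a b A B * kron v w) $$ (x,0) = (\<Sum>k<a*b. controlled a b A B $$ (x,k) * kron v w $$ (k,0))"
    by (rule mult_entry[OF controlled_carrier k x]) simp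
  also have "\<dots> = (\<Sum>i<a. \<Sum>j<b. (A $$ (x div b, i) * v $$ (i,0)) * (B (x div b) $$ (x mod b, j) * w $$ (j,0)))"
    unfolding sum_lessThan_mult using x by (intro sum.cong refl) (simp add: controlled_def add_lt_mult e)
  also have "\<dots> = (A * v) $$ (x div b, 0) * (B (x div b) * w) $$ (x mod b, 0)"
    using div_lt_mult[OF x] mod_lt_mult[OF x] by (simp add: mult_entry[OF A v] mult_entry[OF B w] sum_product)
  finally show ?thesis .
qed

lemma init_state_carrier [simp, intro]: "init_state N \<in> carrier_mat N 1"
  by (simp add: init_state_def)

lemma init_state_mpow: "D > 0 \<Longrightarrow> init_state (D^M) = mpow (init_state D) M"
proof (induction M)
  case 0
  show ?case by (rule eq_matI) (auto simp: init_state_def)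
next
  case (Suc M)
  have "init_state (D^Suc M) = kron (init_state D) (init_state (D^M))"
  proof (rule eq_matI)
    fix x y assume "x < dim_row (kron (init_state D) (init_state (D^M)))" "y < dim_col (kron (init_state D) (init_state (D^M)))"
    then have x: "x < D * D^M" "y = 0" by (auto simp: kron_def init_state_def)
    have "x = 0 \<longleftrightarrow> x div D^M = 0 \<and> x mod D^M = 0" using divmod_eq_iff[of x 0 "D^M"] by simp
    then show "init_state (D^Suc M) $$ (x,y) = kron (init_state D) (init_state (D^M)) $$ (x,y)"
      using x div_lt_mult[OF x(1)] mod_lt_mult[OF x(1)]
      by (auto simp: kron_entry[of _ D 1 _ "D^M" 1] init_state_def)
  qed (auto simp: kron_def init_state_def)
  then show ?case using Suc by simp
qed

text \<open>Row 0 of \<open>pbasis\<close> is the bra of the wanted state since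
  \<open>ps n 0\<close> is the identity; the adjoint thus creates it from the initial state.\<close>

lemma prepare_choi_one: "cadj (pbasis n (1\<^sub>m (2^n))) * init_state (4^n) = choi n (1\<^sub>m (2^n))"
proof (rule eq_matI)
  let ?B = "pbasis n (1\<^sub>m (2^n))"
  fix x y assume "x < dim_row (choi n (1\<^sub>m (2^n)))" "y < dim_col (choi n (1\<^sub>m (2^n)))"
  then have x: "x < 4^n" "y = 0" by (auto simp: choi_def)
  have lt: "x div 2^n < 2^n" "x mod 2^n < 2^n" using x by (auto simp: four_pow intro: div_lt_mult)
  have "(cadj ?B * init_state (4^n)) $$ (x,y) = (\<Sum>k<4^n. cadj ?B $$ (x,k) * init_state (4^n) $$ (k,0))"
    unfolding x(2) by (rule mult_entry[OF cadj_carrier[OF pbasis_carrier] init_state_carrier x(1)]) simp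
  also have "\<dots> = (\<Sum>k<4^n. if k = 0 then cadj ?B $$ (x,k) else 0)"
    by (intro sum.cong refl) (auto simp: init_state_def)
  also have "\<dots> = cnj (?B $$ (0,x))" using x by (simp add: cadj_entry[OF pbasis_carrier])
  also have "\<dots> = choi n (1\<^sub>m (2^n)) $$ (x,y)" using x lt by (simp add: pbasis_def choi_def ps_zero)
  finally show "(cadj ?B * init_state (4^n)) $$ (x,y) = choi n (1\<^sub>m (2^n)) $$ (x,y)" .
qed (auto simp: choi_def init_state_def pbasis_def)

lemma query_choi:
  assumes U: "U \<in> carrier_mat (2^n) (2^n)"
  shows "kron U (1\<^sub>m (2^n)) * choi n (1\<^sub>m (2^n)) = choi n U"
proof (rule eq_matI)
  fix x y assume "x < dim_row (choi n U)" "y < dim_col (choi n U)"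
  then have x: "x < 2^n*2^n" "y = 0" by (auto simp: choi_def four_pow)
  have k: "kron U (1\<^sub>m (2^n)) \<in> carrier_mat (2^n*2^n) (2^n*2^n)" using U by auto
  have ch: "choi n V \<in> carrier_mat (2^n*2^n) 1" for V using choi_carrier[of n V] by (simp only: four_pow)
  have lt: "x div 2^n < 2^n" "x mod 2^n < 2^n" using x by (auto intro: div_lt_mult)
  have "(kron U (1\<^sub>m (2^n)) * choi n (1\<^sub>m (2^n))) $$ (x,y)
    = (\<Sum>z<2^n*2^n. kron U (1\<^sub>m (2^n)) $$ (x,z) * choi n (1\<^sub>m (2^n)) $$ (z,0))"
    unfolding x(2) by (rule mult_entry[OF k ch x(1)]) simp
  also have "\<dots> = (\<Sum>i<2^n. \<Sum>j<2^n. if j = x mod 2^n then (if i = j then U $$ (x div 2^n, i) / complex_of_real (sqrt (2^n)) else 0) else 0)"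
    unfolding sum_lessThan_mult using x lt
    by (intro sum.cong refl) (simp add: choi_entry kron_entry[OF U one_carrier_mat] add_lt_mult)
  also have "\<dots> = U $$ (x div 2^n, x mod 2^n) / complex_of_real (sqrt (2^n))" using lt by simp
  also have "\<dots> = choi n U $$ (x,y)" using x by (simp add: choi_def four_pow)
  finally show "(kron U (1\<^sub>m (2^n)) * choi n (1\<^sub>m (2^n))) $$ (x,y) = choi n U $$ (x,y)" .
qed (use U in \<open>auto simp: choi_def kron_def four_pow\<close>)

text \<open>All \<open>M\<close> maximally entangled pairs are prepared beforehand. Each round
  queries the front pair and rotates it to the back; after \<open>M\<close> rounds every pair has
  become a Choi state of \<open>U\<close>, and \<open>F\<close> is applied to all of them.\<close>

lemma parallel_queries:
  assumes n: "n \<ge> 1" and M: "M \<ge> 1" and F: "unitary ((4^n)^M) F"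
  shows "\<exists>a V0 Vs. valid_algorithm n a V0 Vs \<and> length Vs = M \<and> 2^(n+a) = ((4^n)^M :: nat)
    \<and> (\<forall>U. unitary (2^n) U \<longrightarrow> final_state a U V0 Vs = F * mpow (choi n U) M)"
proof -
  define D where "D = (4^n :: nat)"
  obtain M' where M': "M = Suc M'" using M by (cases M) auto
  \<comment> \<open>In total \<open>2 * n * M\<close> qubits, of which the first \<open>n\<close>
    are the oracle register.\<close>
  define a where "a = n + 2 * n * M'"
  have four: "(4::nat) = 2^2" by simp
  have a2: "2^a = 2^n * D^M'" unfolding a_def D_def four by (simp add: power_add power_mult)
  have na: "2^(n+a) = D^M" unfolding power_add a2 M' by (simp add: D_def four_pow)
  define S where "S = swap_mat D (D^M')"
  have S: "unitary (D^M) S" unfolding S_def M' using swap_mat_unitary[of D "D^M'"] by simp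
  define V0 where "V0 = mpow (cadj (pbasis n (1\<^sub>m (2^n)))) M"
  have V0: "unitary (D^M) V0" unfolding V0_def D_def
    by (intro unitary_mpow unitary_cadj pbasis_unitary unitary_one)
  \<comment> \<open>Exactly one unitary follows each query, so the last rotation is merged with
    \<open>F\<close>.\<close>
  define Vs where "Vs = replicate M' S @ [F * S]"
  have FS: "unitary (D^M) (F * S)" using F S unfolding D_def by (rule unitary_mult)
  have valid: "valid_algorithm n a V0 Vs"
    unfolding valid_algorithm_def na using V0 S FS by (auto simp: Vs_def)
  moreover have "final_state a U V0 Vs = F * mpow (choi n U) M" if U: "unitary (2^n) U" for U
  proof -
    note u = unitary_carrier[OF U]
    define ph ch where "ph = choi n (1\<^sub>m (2^n))" and "ch = choi n U"
    have c: "ph \<in> carrier_mat D 1" "ch \<in> carrier_mat D 1" 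
      by (simp_all add: ph_def ch_def D_def del: One_nat_def)
    have cm: "mpow ph k \<in> carrier_mat (D^k) 1" "mpow ch k \<in> carrier_mat (D^k) 1" for k
      using mpow_carrier[OF c(1), of k] mpow_carrier[OF c(2), of k] by auto
    define step where "step = (\<lambda>s V. V * (kron U (1\<^sub>m (2^a)) * s))"
    have query: "kron U (1\<^sub>m (2^a)) * kron ph B = kron ch B" if B: "B \<in> carrier_mat (D^M') 1" for B
    proof -
      have e: "kron U (1\<^sub>m (2^a)) = kron (kron U (1\<^sub>m (2^n))) (1\<^sub>m (D^M'))"
        unfolding a2 by (simp add: kron_assoc kron_one)
      have "kron U (1\<^sub>m (2^a)) * kron ph B = kron (kron U (1\<^sub>m (2^n)) * ph) (1\<^sub>m (D^M') * B)"
        unfolding e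
      proof (rule kron_mult)
        show "kron U (1\<^sub>m (2^n)) \<in> carrier_mat D D" using kron_carrier[OF u one_carrier_mat] by (simp add: D_def four_pow)
      qed (use c B in auto)
      then show ?thesis using query_choi[OF u] B by (simp add: ph_def ch_def)
    qed
    have one: "step (kron (mpow ph (Suc j)) (mpow ch k)) S = kron (mpow ph j) (mpow ch (Suc k))"
      if jk: "j + k = M'" for j k
    proof -
      have B: "kron (mpow ph j) (mpow ch k) \<in> carrier_mat (D^M') 1"
        using kron_carrier[OF cm(1)[of j] cm(2)[of k]] by (simp flip: power_add add: jk)
      have "step (kron (mpow ph (Suc j)) (mpow ch k)) S = S * kron ch (kron (mpow ph j) (mpow ch k))"
        unfolding step_def by (simp add: kron_assoc query[OF B])
      also have "\<dots> = kron (kron (mpow ph j) (mpow ch k)) ch" unfolding S_def by (rule swap_mat_kron[OF c(2) B])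
      also have "\<dots> = kron (mpow ph j) (mpow ch (Suc k))" unfolding kron_assoc mpow_Suc_right ..
      finally show ?thesis .
    qed
    have evolve: "foldl step (mpow ph M) (replicate k S) = kron (mpow ph (M - k)) (mpow ch k)" if "k \<le> M" for k
      using that
    proof (induction k)
      case (Suc k)
      then have "replicate (Suc k) S = replicate k S @ [S]" by (simp add: replicate_append_same)
      moreover have "M - k = Suc (M' - k)" "M - Suc k = M' - k" using Suc.prems M' by auto
      ultimately show ?case using Suc one[of "M' - k" k] M' by simp
    qed simp
    have init: "V0 * init_state (dim_row U * 2^a) = mpow ph M"
    proof -
      have "dim_row U * 2^a = D^M" using u na by (simp add: power_add)
      then have "V0 * init_state (dim_row U * 2^a) = mpow (cadj (pbasis n (1\<^sub>m (2^n)))) M * mpow (init_state D) M"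
        using init_state_mpow[of D M] by (simp add: V0_def D_def)
      also have "\<dots> = mpow ph M"
        unfolding D_def using mpow_mult[OF cadj_carrier[OF pbasis_carrier] init_state_carrier] 
        by (simp add: prepare_choi_one ph_def)
      finally show ?thesis .
    qed
    have "final_state a U V0 Vs = step (foldl step (mpow ph M) (replicate M' S)) (F * S)"
      unfolding final_state_def init Vs_def step_def by simp
    also have "foldl step (mpow ph M) (replicate M' S) = kron ph (mpow ch M')"
      using evolve[of M'] M' by simp
    also have "step (kron ph (mpow ch M')) (F * S) = (F * S) * kron ch (mpow ch M')"
      unfolding step_def by (simp add: query[OF cm(2)])
    also have "\<dots> = F * (S * kron ch (mpow ch M'))"
    proof (rule assoc_mult_mat)
      show "F \<in> carrier_mat (D^M) (D^M)" "S \<in> carrier_mat (D^M) (D^M)"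
        using unitary_carrier[OF F] unitary_carrier[OF S] by (auto simp: D_def)
      show "kron ch (mpow ch M') \<in> carrier_mat (D^M) 1" using kron_carrier[OF c(2) cm(2)[of M']] M' by simp
    qed
    also have "S * kron ch (mpow ch M') = kron (mpow ch M') ch" unfolding S_def by (rule swap_mat_kron[OF c(2) cm(2)])
    also have "\<dots> = mpow ch M" unfolding M' by (rule mpow_Suc_right)
    finally show ?thesis by (simp add: ch_def)
  qed
  moreover have "length Vs = M" by (simp add: Vs_def M')
  ultimately show ?thesis using na D_def by metis
qed

text \<open>Markov's inequality and a union bound at once: by \<open>fail\<close>, the quantity
  \<open>1 - W - V\<close> is at most the indicator of success, and it only remains to average. The
  bound on \<open>V\<close> has to hold for every first outcome, as the second distribution depends
  on it.\<close>

lemma two_stage: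
  fixes p W :: "nat \<Rightarrow> real" and q V :: "nat \<Rightarrow> nat \<Rightarrow> real"
  assumes p: "\<And>i. i < a \<Longrightarrow> 0 \<le> p i" "(\<Sum>i<a. p i) = 1"
    and q: "\<And>i j. i < a \<Longrightarrow> j < b \<Longrightarrow> 0 \<le> q i j" "\<And>i. i < a \<Longrightarrow> (\<Sum>j<b. q i j) = 1"
    and W: "\<And>i. i < a \<Longrightarrow> 0 \<le> W i" and V: "\<And>i j. i < a \<Longrightarrow> j < b \<Longrightarrow> 0 \<le> V i j"
    and fail: "\<And>i j. i < a \<Longrightarrow> j < b \<Longrightarrow> \<not> good i j \<Longrightarrow> 1 \<le> W i + V i j"
    and eW: "(\<Sum>i<a. p i * W i) \<le> e1" and eV: "\<And>i. i < a \<Longrightarrow> (\<Sum>j<b. q i j * V i j) \<le> e2"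
  shows "(\<Sum>x<a*b. if good (x div b) (x mod b) then p (x div b) * q (x div b) (x mod b) else 0) \<ge> 1 - e1 - e2"
proof -
  have "1 - e1 - e2 \<le> 1 - (\<Sum>i<a. p i * W i) - (\<Sum>i<a. p i * (\<Sum>j<b. q i j * V i j))"
  proof -
    have "(\<Sum>i<a. p i * (\<Sum>j<b. q i j * V i j)) \<le> (\<Sum>i<a. p i * e2)"
      by (intro sum_mono mult_left_mono) (auto simp: p eV)
    also have "\<dots> = e2" by (simp add: p(2) flip: sum_distrib_right)
    finally show ?thesis using eW by simp
  qed
  also have "\<dots> = (\<Sum>i<a. p i * ((\<Sum>j<b. q i j) - W i * (\<Sum>j<b. q i j) - (\<Sum>j<b. q i j * V i j)))"
    using p(2) by (simp add: q(2) right_diff_distrib sum_subtractf)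
  also have "\<dots> = (\<Sum>i<a. p i * (\<Sum>j<b. q i j * (1 - W i - V i j)))"
    by (simp add: algebra_simps sum_subtractf sum.distrib sum_distrib_left)
  also have "\<dots> \<le> (\<Sum>i<a. p i * (\<Sum>j<b. if good i j then q i j else 0))"
  proof (intro sum_mono mult_left_mono)
    fix i j assume "i \<in> {..<a}" "j \<in> {..<b}"
    then have ij: "i < a" "j < b" by auto
    show "q i j * (1 - W i - V i j) \<le> (if good i j then q i j else 0)"
      using q(1)[OF ij] W[OF ij(1)] V[OF ij] fail[OF ij]
      by (auto simp: mult_le_cancel_left1 mult_le_0_iff intro!: mult_left_le)
  qed (auto simp: p)
  also have "\<dots> = (\<Sum>x<a*b. if good (x div b) (x mod b) then p (x div b) * q (x div b) (x mod b) else 0)"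
    unfolding sum_lessThan_mult sum_distrib_left by (intro sum.cong refl) auto
  finally show ?thesis .
qed

section \<open>Analysis of the learning algorithm\<close>

lemma sum_two_valued:
  fixes P z :: "nat \<Rightarrow> real"
  assumes P: "\<And>i. i < N \<Longrightarrow> 0 \<le> P i" "(\<Sum>i<N. P i) = 1"
    and z: "\<And>i. z i = 1 \<or> z i = -1"
  shows "(\<Sum>i<N. P i * (if z i = 1 then u else v)) = (u + v) / 2 + (u - v) / 2 * (\<Sum>i<N. z i * P i)"
proof -
  have "P i * (if z i = 1 then u else v) = (u + v) / 2 * P i + (u - v) / 2 * (z i * P i)" for i
    using z[of i] by (auto simp: field_simps)
  then show ?thesis by (simp only: sum.distrib sum_distrib_left[symmetric] P(2) mult_1_right)
qed

text \<open>Weights of a Chernoff bound: with \<open>z = \<plusminus>1\<close> of mean \<open>\<mu>\<close>, the weight \<open>exp (\<lambda> (1/2 - z))\<close>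
  has expectation below \<open>1\<close> if \<open>\<mu> \<ge> 9/16\<close>, and its inverse does if \<open>\<mu> \<le> 7/16\<close>;
  \<open>21/20\<close> is \<open>exp (\<lambda>/2)\<close>.\<close>

definition wt :: "nat \<Rightarrow> nat \<Rightarrow> nat \<Rightarrow> nat \<Rightarrow> real" where
  "wt n p q x = (if psign n p (x div 4^n) * psign n q (x mod 4^n) = 1 then 20/21 else (21/20)^3)"

text \<open>A product of the exponential weights is below 1 iff the observed signs have mean above
  1/2, the midpoint of 7/16 and 9/16.\<close>

definition accept :: "nat \<Rightarrow> nat \<Rightarrow> nat \<Rightarrow> nat \<Rightarrow> nat \<Rightarrow> bool" where
  "accept n m x p q \<longleftrightarrow> tpow (4^n*4^n) (wt n p q) m x < 1"

text \<open>The default value only serves to make \<open>decode\<close> unitary in every case.\<close>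

definition decode :: "nat \<Rightarrow> nat \<Rightarrow> nat \<Rightarrow> complex mat" where
  "decode n m x = (if \<exists>C\<in>clifford n. \<forall>q<4^n. \<exists>p<4^n. accept n m x p q \<and> related n C p q
     then SOME C. C \<in> clifford n \<and> (\<forall>q<4^n. \<exists>p<4^n. accept n m x p q \<and> related n C p q)
     else 1\<^sub>m (2^n))"

text \<open>Over a sample the product is below 1 iff \<open>s\<close> is a strict majority; like
  \<open>wt\<close>, it is both the decision rule and the weight of the Chernoff bound.\<close>

definition vote :: "nat \<Rightarrow> nat \<Rightarrow> real" where
  "vote s t = (if t = s then 1/2 else 2)"

definition wins :: "nat \<Rightarrow> nat \<Rightarrow> nat \<Rightarrow> nat \<Rightarrow> bool" where
  "wins n k y s \<longleftrightarrow> s < 4^n \<and> tpow (4^n) (vote s) k y < 1"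

lemma wt_pos: "0 < wt n p q x"
  by (simp add: wt_def)

text \<open>For distinct candidates the two votes on any draw multiply to at least 1, so the two
  products cannot both be below 1.\<close>

lemma wins_unique:
  assumes "wins n k y s" "wins n k y t"
  shows "s = t"
proof (rule ccontr)
  assume "s \<noteq> t"
  have pos: "0 < tpow (4^n) (vote t) k y" by (rule tpow_pos) (simp add: vote_def)
  have "1 = tpow (4^n) (\<lambda>i. 1 :: real) k y" by (simp add: tpow_const_one)
  also have "\<dots> \<le> tpow (4^n) (\<lambda>i. vote s i * vote t i) k y"
    using \<open>s \<noteq> t\<close> by (intro tpow_mono[THEN conjunct2]) (auto simp: vote_def)
  also have "\<dots> = tpow (4^n) (vote s) k y * tpow (4^n) (vote t) k y" by (rule tpow_mult)
  also have "\<dots> < 1 * 1"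
    using assms by (intro mult_strict_mono) (auto simp: wins_def intro!: less_imp_le[OF pos])
  finally show False by simp
qed

lemma decode_unitary: "unitary (2^n) (decode n m x)"
proof (cases "\<exists>C\<in>clifford n. \<forall>q<4^n. \<exists>p<4^n. accept n m x p q \<and> related n C p q")
  case True
  then have "\<exists>C. C \<in> clifford n \<and> (\<forall>q<4^n. \<exists>p<4^n. accept n m x p q \<and> related n C p q)" by blast
  from someI_ex[OF this] True show ?thesis by (simp add: decode_def clifford_unitary)
next
  case False
  show ?thesis unfolding decode_def if_not_P[OF False] by simp
qed

text \<open>If every test is right, \<open>C\<close> itself qualifies for the choice in
  \<open>decode\<close>; whatever is chosen then shares all relations with \<open>C\<close>.\<close>

lemma decode_coset:
  assumes C: "C \<in> clifford n" and ok: "\<And>p q. p < 4^n \<Longrightarrow> q < 4^n \<Longrightarrow> accept n m x p q \<longleftrightarrow> related n C p q"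
  shows "\<exists>r<4^n. \<exists>c. cmod c = 1 \<and> C = c \<cdot>\<^sub>m (decode n m x * ps n r)"
proof -
  let ?P = "\<lambda>C. C \<in> clifford n \<and> (\<forall>q<4^n. \<exists>p<4^n. accept n m x p q \<and> related n C p q)"
  have "?P C" using C ok related_ex[OF C] by blast
  then have ex: "\<exists>C. ?P C" by blast
  then have "decode n m x = (SOME C. ?P C)" unfolding decode_def by (intro if_P) blast
  with someI_ex[OF ex] have "?P (decode n m x)" by simp
  then have "\<exists>p. related n C p q \<and> related n (decode n m x) p q" if "q < 4^n" for q
    using that ok by blast
  then show ?thesis by (intro clifford_coset clifford_unitary[OF C] decode_unitary)
qed

text \<open>The square of \<open>sqrt 2 / 4\<close> is 1/8, which by \<open>Dist_hs\<close> bounds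
  the missing squared overlap.\<close>

lemma overlap_bound:
  assumes U: "unitary (2^n) U" and C: "unitary (2^n) C" and D: "Dist U C < sqrt 2 / 4"
  shows "(cmod (hs C U) / 2^n)\<^sup>2 \<ge> 7/8"
proof -
  have "0 \<le> Dist U C" by (simp add: Dist_def frob_def sum_nonneg)
  then have "(Dist U C)\<^sup>2 \<le> (sqrt 2 / 4)\<^sup>2" using D by (intro power_mono) auto
  then show ?thesis using Dist_hs[OF U C] by (simp add: power_divide)
qed

lemma power_three_mult: "(x * x)^m * x^m = (x::nat)^(3*m)"
  by (simp only: power_mult power3_eq_cube power_mult_distrib)

lemma unimodular_exp:
  assumes "cmod z = 1"
  shows "\<exists>\<theta>. z = exp (\<i> * complex_of_real \<theta>)"
proof
  show "z = exp (\<i> * complex_of_real (Arg z))"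
    using rcis_cmod_Arg[of z] assms by (simp add: rcis_def cis_conv_exp)
qed

lemma equal_up_to_phase_smult:
  assumes "cmod k = 1" "C = k \<cdot>\<^sub>m W"
  shows "equal_up_to_phase W C"
proof -
  have "cnj k * k = 1" using complex_norm_square[of k] assms(1) by (simp add: mult.commute)
  then have "W = cnj k \<cdot>\<^sub>m C" unfolding assms(2) by simp
  moreover have "\<exists>\<theta>. cnj k = exp (\<i> * complex_of_real \<theta>)" using unimodular_exp[of "cnj k"] assms(1) by simp
  ultimately show ?thesis unfolding equal_up_to_phase_def by auto
qed

text \<open>Of the \<open>3 * m\<close> copies, \<open>2 * m\<close> form the Bell pairs that
  determine \<open>decode\<close> and \<open>m\<close> vote on the Pauli factor. The two subtracted
  terms bound the expected weights of the two stages; \<open>16^n\<close> counts the tested pairs of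
  strings.\<close>

lemma learner_success:
  fixes m :: nat
  assumes U: "unitary (2^n) U" and C: "C \<in> clifford n" and D: "Dist U C < sqrt 2 / 4"
  defines "F \<equiv> controlled ((4^n*4^n)^m) ((4^n)^m) (mpow (bell n) m) (\<lambda>x. mpow (pbasis n (decode n m x)) m)"
    and "good \<equiv> \<lambda>x y. equal_up_to_phase (decode n m x * ps n (SOME s. wins n m y s)) C"
  shows "(\<Sum>z<(4^n)^(3*m). if good (z div (4^n)^m) (z mod (4^n)^m)
      then (cmod ((F * mpow (choi n U) (3*m)) $$ (z,0)))\<^sup>2 else 0) \<ge> 1 - 16^n * (998/1000)^m - (11/16)^m"
proof -
  let ?D = "4^n :: nat"
  define a b where "a = (?D*?D)^m" and "b = ?D^m"
  note UC = clifford_unitary[OF C]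
  note c = unitary_carrier[OF UC] unitary_carrier[OF U]
  have f: "(cmod (hs C U) / 2^n)\<^sup>2 \<ge> 7/8" by (rule overlap_bound[OF U UC D])
  let ?v = "choi n U"
  let ?vv = "kron ?v ?v"
  have vv: "?vv \<in> carrier_mat (?D*?D) 1" using kron_carrier[OF choi_carrier choi_carrier, of n U n U] by simp
  define P where "P i = (cmod ((bell n * ?vv) $$ (i,0)))\<^sup>2" for i
  define Q where "Q x s = (cmod ((pbasis n (decode n m x) * ?v) $$ (s,0)))\<^sup>2" for x s
  define p where "p = tpow (?D*?D) P m"
  define q where "q x = tpow ?D (Q x) m" for x
  have vvn: "(\<Sum>i<?D*?D. (cmod (?vv $$ (i,0)))\<^sup>2) = 1"
  proof -
    have "(\<Sum>i<?D*?D. (cmod (?vv $$ (i,0)))\<^sup>2) = (\<Sum>i<?D. \<Sum>j<?D. (cmod (?v $$ (i,0)))\<^sup>2 * (cmod (?v $$ (j,0)))\<^sup>2)"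
      unfolding sum_lessThan_mult
      by (intro sum.cong refl)
         (simp add: kron_entry[OF choi_carrier choi_carrier] add_lt_mult norm_mult power_mult_distrib)
    also have "\<dots> = 1" by (simp add: choi_norm[OF U] flip: sum_product)
    finally show ?thesis .
  qed
  have P: "0 \<le> P i" "(\<Sum>i<?D*?D. P i) = 1" for i
    unfolding P_def using unitary_norm_column[OF bell_unitary vv] vvn by auto
  have Q: "0 \<le> Q x i" "(\<Sum>i<?D. Q x i) = 1" for x i
    unfolding Q_def using unitary_norm_column[OF pbasis_unitary[OF decode_unitary] choi_carrier] choi_norm[OF U] by auto
  have amp: "(cmod ((F * mpow ?v (3*m)) $$ (z,0)))\<^sup>2 = p (z div b) * q (z div b) (z mod b)" if z: "z < a*b" for z
  proof -
    have "3 * m = 2 * m + m" by simp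
    then have split: "mpow ?v (3*m) = kron (mpow ?vv m) (mpow ?v m)" by (simp only: mpow_kron_self mpow_add)
    have "(F * mpow ?v (3*m)) $$ (z,0)
      = (mpow (bell n) m * mpow ?vv m) $$ (z div b, 0) * (mpow (pbasis n (decode n m (z div b))) m * mpow ?v m) $$ (z mod b, 0)"
      unfolding F_def split a_def[symmetric] b_def[symmetric]
    proof (rule controlled_kron[OF _ _ _ _ z])
      show "mpow ?vv m \<in> carrier_mat a 1" "mpow ?v m \<in> carrier_mat b 1"
        using mpow_carrier[OF vv, of m] mpow_carrier[OF choi_carrier[of n U], of m] by (simp_all add: a_def b_def)
    qed (auto simp: a_def b_def)
    also have "mpow (bell n) m * mpow ?vv m = mpow (bell n * ?vv) m" by (rule mpow_mult[OF bell_carrier vv])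
    also have "mpow (pbasis n (decode n m (z div b))) m * mpow ?v m = mpow (pbasis n (decode n m (z div b)) * ?v) m"
      by (rule mpow_mult[OF pbasis_carrier choi_carrier])
    also have "mpow (bell n * ?vv) m $$ (z div b, 0) = tpow (?D*?D) (\<lambda>i. (bell n * ?vv) $$ (i,0)) m (z div b)"
      using div_lt_mult[OF z] by (intro mpow_column mult_carrier_mat[OF bell_carrier vv]) (simp add: a_def)
    also have "mpow (pbasis n (decode n m (z div b)) * ?v) m $$ (z mod b, 0)
      = tpow ?D (\<lambda>i. (pbasis n (decode n m (z div b)) * ?v) $$ (i,0)) m (z mod b)"
      using mod_lt_mult[OF z] by (intro mpow_column mult_carrier_mat[OF pbasis_carrier choi_carrier]) (simp add: b_def)
    finally show ?thesis by (simp add: norm_mult power_mult_distrib cmod_tpow p_def q_def P_def[abs_def] Q_def[abs_def])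
  qed
  \<comment> \<open>For an unrelated pair a failure is a product of \<open>wt\<close> below 1, hence
    the inverse weight.\<close>
  define w where "w i j = (if related n C i j then wt n i j else (\<lambda>x. 1 / wt n i j x))" for i j
  define W where "W x = (\<Sum>i<?D. \<Sum>j<?D. tpow (?D*?D) (w i j) m x)" for x
  define s0 where "s0 x = (SOME r. r < 4^n \<and> (\<exists>c. cmod c = 1 \<and> C = c \<cdot>\<^sub>m (decode n m x * ps n r)))" for x
  \<comment> \<open>Where \<open>W x\<close> is at least 1 the failure is already paid for, and
    \<open>s0 x\<close> need not be meaningful there.\<close>
  define V where "V x y = (if W x < 1 then tpow ?D (vote (s0 x)) m y else 0)" for x y
  have wpos: "0 < w i j x" for i j x using wt_pos by (simp add: w_def)
  have Wnn: "0 \<le> W x" for x unfolding W_def using wpos by (intro sum_nonneg less_imp_le tpow_pos)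
  have right: "accept n m x i j \<longleftrightarrow> related n C i j" if W: "W x < 1" and ij: "i < ?D" "j < ?D" for x i j
  proof -
    have "tpow (?D*?D) (w i j) m x \<le> W x"
    proof -
      have nn: "0 \<le> tpow (?D*?D) (w i j) m x" for i j using wpos by (intro less_imp_le tpow_pos)
      have "tpow (?D*?D) (w i j) m x \<le> (\<Sum>j<?D. tpow (?D*?D) (w i j) m x)"
        using ij nn by (intro member_le_sum) auto
      also have "\<dots> \<le> W x" unfolding W_def using ij nn
        by (intro member_le_sum[where f = "\<lambda>i. \<Sum>j<?D. tpow (?D*?D) (w i j) m x"]) (auto intro: sum_nonneg)
      finally show ?thesis .
    qed
    then have lt: "tpow (?D*?D) (w i j) m x < 1" using W by simp
    show ?thesis
    proof (cases "related n C i j")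
      case True
      then show ?thesis using lt by (simp add: accept_def w_def)
    next
      case False
      have "tpow (?D*?D) (w i j) m x * tpow (?D*?D) (wt n i j) m x = tpow (?D*?D) (\<lambda>i. 1) m x"
        unfolding tpow_mult[symmetric] using False wt_pos by (simp add: w_def less_imp_neq[symmetric])
      then have e: "tpow (?D*?D) (w i j) m x * tpow (?D*?D) (wt n i j) m x = 1" by (simp add: tpow_const_one)
      have "\<not> tpow (?D*?D) (wt n i j) m x < 1"
      proof
        assume "tpow (?D*?D) (wt n i j) m x < 1"
        then have "tpow (?D*?D) (w i j) m x * tpow (?D*?D) (wt n i j) m x < 1 * 1"
          using lt wpos wt_pos by (intro mult_strict_mono) (auto intro!: less_imp_le tpow_pos)
        then show False using e by simp
      qed
      then show ?thesis using False by (simp add: accept_def)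
    qed
  qed
  have s0: "s0 x < 4^n \<and> (\<exists>c. cmod c = 1 \<and> C = c \<cdot>\<^sub>m (decode n m x * ps n (s0 x)))" if W: "W x < 1" for x
  proof -
    have "\<exists>r. r < 4^n \<and> (\<exists>c. cmod c = 1 \<and> C = c \<cdot>\<^sub>m (decode n m x * ps n r))"
      using decode_coset[OF C right[OF W]] by blast
    from someI_ex[OF this] show ?thesis by (simp add: s0_def)
  qed
  \<comment> \<open>The worst cases, squared correlation 9/16 for related and 7/16 for unrelated
    pairs, give about 0.9973 and 0.9976; 998/1000 is above both.\<close>
  have ew: "(\<Sum>x<?D*?D. P x * w i j x) \<le> 998/1000" if ij: "i < ?D" "j < ?D" for i j
  proof -
    let ?z = "\<lambda>x. psign n i (x div 4^n) * psign n j (x mod 4^n)"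
    let ?c = "corr n U (ps n i) (ps n j)"
    have z: "?z x = 1 \<or> ?z x = -1" for x
      using psign_cases[of n i "x div 4^n"] psign_cases[of n j "x mod 4^n"] by auto
    have mean: "(\<Sum>x<?D*?D. ?z x * P x) = ?c\<^sup>2" unfolding P_def by (rule bell_mean[OF U])
    show ?thesis
    proof (cases "related n C i j")
      case True
      have "(\<Sum>x<?D*?D. P x * w i j x) = (\<Sum>x<?D*?D. P x * (if ?z x = 1 then 20/21 else (21/20)^3))"
        using True by (simp add: w_def wt_def)
      also have "\<dots> = (20/21 + (21/20)^3) / 2 + (20/21 - (21/20)^3) / 2 * ?c\<^sup>2"
        unfolding mean[symmetric] by (rule sum_two_valued[OF P z])
      also have "(3/4)\<^sup>2 \<le> \<bar>?c\<bar>\<^sup>2"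
        using corr_related[OF U UC True] f by (intro power_mono) auto
      then have "(20/21 + (21/20)^3) / 2 + (20/21 - (21/20)^3) / 2 * ?c\<^sup>2 \<le> 998/1000"
        by (simp add: power2_eq_square power3_eq_cube)
      finally show ?thesis .
    next
      case False
      have "(\<Sum>x<?D*?D. P x * w i j x) = (\<Sum>x<?D*?D. P x * (if ?z x = 1 then 21/20 else (20/21)^3))"
        using False by (intro sum.cong refl) (simp add: w_def wt_def power3_eq_cube)
      also have "\<dots> = (21/20 + (20/21)^3) / 2 + (21/20 - (20/21)^3) / 2 * ?c\<^sup>2"
        unfolding mean[symmetric] by (rule sum_two_valued[OF P z])
      also have "?c\<^sup>2 \<le> 7/16"
      proof -
        have "?c\<^sup>2 \<le> 1 - (2 * (cmod (hs C U) / 2^n)\<^sup>2 - 1)\<^sup>2"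
          using f by (intro corr_not_related[OF U C ij False]) simp
        also have "(3/4)\<^sup>2 \<le> (2 * (cmod (hs C U) / 2^n)\<^sup>2 - 1)\<^sup>2" using f by (intro power_mono) auto
        then have "1 - (2 * (cmod (hs C U) / 2^n)\<^sup>2 - 1)\<^sup>2 \<le> 7/16" by (simp add: power2_eq_square)
        finally show ?thesis .
      qed
      then have "(21/20 + (20/21)^3) / 2 + (21/20 - (20/21)^3) / 2 * ?c\<^sup>2 \<le> 998/1000"
        by (simp add: power3_eq_cube)
      finally show ?thesis .
    qed
  qed
  have "(\<Sum>z<a*b. if good (z div b) (z mod b) then p (z div b) * q (z div b) (z mod b) else 0)
     \<ge> 1 - 16^n * (998/1000)^m - (11/16)^m"
  proof (rule two_stage[where W = W and V = V])
    show "0 \<le> p i" for i unfolding p_def using tpow_mono[of P P] P by auto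
    show "(\<Sum>i<a. p i) = 1" unfolding p_def a_def sum_tpow by (simp add: P)
    show "0 \<le> q i j" for i j unfolding q_def using tpow_mono[of "Q i" "Q i"] Q by auto
    show "(\<Sum>j<b. q i j) = 1" for i unfolding q_def b_def sum_tpow by (simp add: Q)
    show "0 \<le> W i" for i by (rule Wnn)
    show "0 \<le> V i j" for i j unfolding V_def by (auto intro!: less_imp_le tpow_pos simp: vote_def)
    show "1 \<le> W i + V i j" if j: "j < b" and ng: "\<not> good i j" for i j
    proof (rule ccontr)
      assume "\<not> ?thesis"
      then have small: "W i + V i j < 1" by simp
      moreover have "0 \<le> V i j" unfolding V_def by (auto intro!: less_imp_le tpow_pos simp: vote_def)
      ultimately have Wi: "W i < 1" by simp
      then have "tpow ?D (vote (s0 i)) m j < 1" using small Wnn[of i] by (simp add: V_def)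
      then have win: "wins n m j (s0 i)" using s0[OF Wi] by (simp add: wins_def)
      then have sel: "(SOME s. wins n m j s) = s0 i" by (intro some_equality wins_unique)
      obtain k where k: "cmod k = 1" "C = k \<cdot>\<^sub>m (decode n m i * ps n (s0 i))" using s0[OF Wi] by blast
      have "good i j" unfolding good_def sel by (rule equal_up_to_phase_smult[OF k])
      with ng show False ..
    qed
    show "(\<Sum>i<a. p i * W i) \<le> 16^n * (998/1000)^m"
    proof -
      have "(\<Sum>x<a. p x * W x) = (\<Sum>x<a. \<Sum>i<?D. \<Sum>j<?D. tpow (?D*?D) (\<lambda>x. P x * w i j x) m x)"
        unfolding W_def p_def tpow_mult by (simp only: sum_distrib_left)
      also have "\<dots> = (\<Sum>i<?D. \<Sum>x<a. \<Sum>j<?D. tpow (?D*?D) (\<lambda>x. P x * w i j x) m x)" by (rule sum.swap)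
      also have "\<dots> = (\<Sum>i<?D. \<Sum>j<?D. \<Sum>x<a. tpow (?D*?D) (\<lambda>x. P x * w i j x) m x)"
        by (intro sum.cong refl sum.swap)
      also have "\<dots> \<le> (\<Sum>i<?D. \<Sum>j<?D. (998/1000)^m)"
        unfolding a_def sum_tpow using ew P wpos
        by (intro sum_mono power_mono sum_nonneg mult_nonneg_nonneg) (auto intro: less_imp_le)
      also have "\<dots> = 16^n * (998/1000)^m"
        by (simp flip: power_mult_distrib)
      finally show ?thesis .
    qed
    show "(\<Sum>j<b. q i j * V i j) \<le> (11/16)^m" for i
    proof (cases "W i < 1")
      case True
      obtain k where k: "cmod k = 1" "C = k \<cdot>\<^sub>m (decode n m i * ps n (s0 i))" and s: "s0 i < ?D" using s0[OF True] by blast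
      have "Q i (s0 i) = (cmod (hs (decode n m i * ps n (s0 i)) U / 2^n))\<^sup>2"
        unfolding Q_def using pbasis_choi[OF unitary_carrier[OF decode_unitary] s] by simp
      also have "cmod (hs (decode n m i * ps n (s0 i)) U / 2^n) = cmod (hs C U) / 2^n"
        unfolding k(2) hs_smult_left by (simp add: norm_mult norm_divide norm_power k(1))
      finally have Qs: "Q i (s0 i) \<ge> 7/8" using f by simp
      \<comment> \<open>The mean vote is \<open>2 - 3/2 * Q i (s0 i)\<close>, and 7/8 for the true
        factor yields the 11/16.\<close>
      have "(\<Sum>t<?D. Q i t * vote (s0 i) t) = (\<Sum>t<?D. 2 * Q i t - (if t = s0 i then 3/2 * Q i t else 0))"
        by (intro sum.cong refl) (auto simp: vote_def)
      also have "\<dots> = 2 - 3/2 * Q i (s0 i)" using s Q(2)[of i] by (simp add: sum_subtractf flip: sum_distrib_left)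
      also have "\<dots> \<le> 11/16" using Qs by simp
      finally have e: "(\<Sum>t<?D. Q i t * vote (s0 i) t) \<le> 11/16" .
      have "(\<Sum>j<b. q i j * V i j) = (\<Sum>t<?D. Q i t * vote (s0 i) t)^m"
        unfolding q_def V_def b_def sum_tpow[symmetric] tpow_mult using True by simp
      also have "\<dots> \<le> (11/16)^m" using e Q(1) by (intro power_mono sum_nonneg) (auto simp: vote_def)
      finally show ?thesis .
    qed (simp add: V_def)
  qed
  also have "(\<Sum>z<a*b. if good (z div b) (z mod b) then p (z div b) * q (z div b) (z mod b) else 0)
    = (\<Sum>z<a*b. if good (z div b) (z mod b) then (cmod ((F * mpow ?v (3*m)) $$ (z,0)))\<^sup>2 else 0)"
    by (intro sum.cong refl) (simp add: amp)
  also have "a * b = ?D^(3*m)"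
    unfolding a_def b_def by (rule power_three_mult)
  finally show ?thesis by (simp only: b_def)
qed

lemma learner:
  assumes n: "n \<ge> 1" and m: "m \<ge> 1"
  shows "\<exists>a V0 Vs out. valid_algorithm n a V0 Vs \<and> length Vs = 3 * m \<and>
    (\<forall>U C. unitary (2^n) U \<longrightarrow> C \<in> clifford n \<longrightarrow> Dist U C < sqrt 2 / 4 \<longrightarrow>
       success_prob n a V0 Vs out U C \<ge> 1 - 16^n * (998/1000)^m - (11/16)^m)"
proof -
  define F where "F = controlled ((4^n*4^n)^m) ((4^n)^m) (mpow (bell n) m) (\<lambda>x. mpow (pbasis n (decode n m x)) m)"
  have "(4^n*4^n)^m * (4^n)^m = ((4^n)^(3*m) :: nat)"
    by (rule power_three_mult)
  then have F: "unitary ((4^n)^(3*m)) F"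
    unfolding F_def by (metis controlled_unitary unitary_mpow bell_unitary pbasis_unitary decode_unitary)
  obtain a V0 Vs where alg: "valid_algorithm n a V0 Vs" "length Vs = 3 * m" "2^(n+a) = ((4^n)^(3*m) :: nat)"
    "\<And>U. unitary (2^n) U \<Longrightarrow> final_state a U V0 Vs = F * mpow (choi n U) (3*m)"
    using parallel_queries[OF n _ F] m by auto
  define out where "out z = decode n m (z div (4^n)^m) * ps n (SOME s. wins n m (z mod (4^n)^m) s)" for z
  have "success_prob n a V0 Vs out U C \<ge> 1 - 16^n * (998/1000)^m - (11/16)^m"
    if "unitary (2^n) U" "C \<in> clifford n" "Dist U C < sqrt 2 / 4" for U C
    using learner_success[OF that] unfolding success_prob_def alg(3) alg(4)[OF that(1)] out_def F_def .
  with alg(1,2) show ?thesis by blast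
qed

section \<open>Guessing without queries\<close>

text \<open>The relation on strings takes finitely many values and determines a Clifford unitary up
  to a string and a phase, by \<open>clifford_coset\<close>. One representative per relation, times
  all strings, suffices.\<close>

lemma clifford_finite_reps:
  "\<exists>T. finite T \<and> (\<forall>C\<in>clifford n. \<exists>W\<in>T. equal_up_to_phase W C)"
proof -
  define sg where "sg C = {(p,q). p < 4^n \<and> q < 4^n \<and> related n C p q}" for C
  define rep where "rep \<sigma> = (SOME C. C \<in> clifford n \<and> sg C = \<sigma>)" for \<sigma>
  define T where "T = (\<lambda>(\<sigma>,r). rep \<sigma> * ps n r) ` (Pow ({..<4^n} \<times> {..<4^n}) \<times> {..<4^n})"
  have "finite T" unfolding T_def by (intro finite_imageI finite_cartesian_product) auto
  moreover have "\<exists>W\<in>T. equal_up_to_phase W C" if C: "C \<in> clifford n" for C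
  proof -
    have rep: "rep (sg C) \<in> clifford n \<and> sg (rep (sg C)) = sg C"
      unfolding rep_def by (rule someI[of _ C]) (use C in simp)
    have "\<exists>p. related n C p q \<and> related n (rep (sg C)) p q" if q: "q < 4^n" for q
    proof -
      obtain p where p: "p < 4^n" "related n C p q" using related_ex[OF C q] by blast
      then have "(p,q) \<in> sg C" using q by (simp add: sg_def)
      then have "(p,q) \<in> sg (rep (sg C))" using rep by simp
      then show ?thesis using p by (auto simp: sg_def)
    qed
    from clifford_coset[OF clifford_unitary[OF C] clifford_unitary[OF conjunct1[OF rep]] this]
    obtain r c where r: "r < 4^n" "cmod c = 1" "C = c \<cdot>\<^sub>m (rep (sg C) * ps n r)" by blast
    have "rep (sg C) * ps n r \<in> T"
      unfolding T_def using r(1) by (intro image_eqI[where x = "(sg C, r)"]) (auto simp: sg_def)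
    moreover have "equal_up_to_phase (rep (sg C) * ps n r) C" using r(2,3) by (rule equal_up_to_phase_smult)
    ultimately show ?thesis ..
  qed
  ultimately show ?thesis by blast
qed

definition hadamard :: "complex mat" where
  "hadamard = mat 2 2 (\<lambda>(i,j). if i = 1 \<and> j = 1 then - 1 / complex_of_real (sqrt 2) else 1 / complex_of_real (sqrt 2))"

lemma hadamard_carrier: "hadamard \<in> carrier_mat 2 2"
  by (simp add: hadamard_def)

lemma hadamard_unitary: "unitary 2 hadamard"
proof (rule unitaryI[OF hadamard_carrier])
  fix i j :: nat assume ij: "i < 2" "j < 2"
  have two: "{..<2::nat} = {0, Suc 0}" by auto
  have s: "complex_of_real (sqrt 2) * complex_of_real (sqrt 2) = 2" unfolding of_real_mult[symmetric] by simp
  show "(\<Sum>k<2. hadamard $$ (i,k) * cnj (hadamard $$ (j,k))) = (if i = j then 1 else 0)"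
    using ij unfolding two less_2_cases_iff by (auto simp: hadamard_def s)
qed

lemma uniform_state:
  assumes "x < 2^N"
  shows "(cmod ((mpow hadamard N * init_state (2^N)) $$ (x,0)))\<^sup>2 = (1/2)^N"
proof -
  have i: "hadamard * init_state 2 \<in> carrier_mat 2 1" by (rule mult_carrier_mat[OF hadamard_carrier init_state_carrier])
  have e: "(cmod ((hadamard * init_state 2) $$ (i,0)))\<^sup>2 = 1/2" if "i < 2" for i
  proof -
    have two: "{..<2::nat} = {0, Suc 0}" by auto
    have "(hadamard * init_state 2) $$ (i,0) = (\<Sum>l<2. hadamard $$ (i,l) * init_state 2 $$ (l,0))"
      by (rule mult_entry[OF hadamard_carrier init_state_carrier that]) simp
    also have "\<dots> = 1 / complex_of_real (sqrt 2)"
      using that unfolding two by (simp add: init_state_def hadamard_def)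
    finally show ?thesis by (simp add: norm_divide power_divide)
  qed
  have t: "tpow 2 f N x = (1/2)^N" if "x < 2^N" "\<And>i. i < 2 \<Longrightarrow> f i = 1/2" for f :: "nat \<Rightarrow> real" and N x
    using that(1)
  proof (induction N arbitrary: x)
    case (Suc N)
    then have "x < 2 * 2^N" by simp
    then show ?case using Suc.IH[of "x mod 2^N"] that(2) by (simp add: div_lt_mult mod_lt_mult)
  qed simp
  have "mpow hadamard N * init_state (2^N) = mpow (hadamard * init_state 2) N"
    using mpow_mult[OF hadamard_carrier init_state_carrier] init_state_mpow[of 2 N] by simp
  then show ?thesis using assms e by (simp add: mpow_column[OF i] cmod_tpow t del: index_mult_mat)
qed

text \<open>Hadamard gates make all outcomes equally likely, and the first ones enumerate the
  representatives. The probability \<open>p0\<close> is tiny but depends on \<open>n\<close>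
  only.\<close>

lemma uniform_guess:
  "\<exists>a V0 out p0. 0 < p0 \<and> valid_algorithm n a V0 [] \<and>
    (\<forall>U C. unitary (2^n) U \<longrightarrow> C \<in> clifford n \<longrightarrow> success_prob n a V0 [] out U C \<ge> p0)"
proof -
  obtain T where T: "finite T" "\<And>C. C \<in> clifford n \<Longrightarrow> \<exists>W\<in>T. equal_up_to_phase W C"
    using clifford_finite_reps[of n] by blast
  obtain out where out: "bij_betw out {0..<card T} T" using ex_bij_betw_nat_finite[OF T(1)] by blast
  \<comment> \<open>A crude choice: \<open>k < 2^k\<close> ensures enough outcomes for all
    representatives.\<close>
  define a where "a = card T"
  define V0 where "V0 = mpow hadamard (n+a)"
  have card: "card T \<le> 2^(n+a)" unfolding a_def by (rule order.trans[OF less_imp_le[OF less_exp] power_increasing]) auto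
  have "success_prob n a V0 [] out U C \<ge> (1/2)^(n+a)" if U: "unitary (2^n) U" and C: "C \<in> clifford n" for U C
  proof -
    obtain W where W: "W \<in> T" "equal_up_to_phase W C" using T(2)[OF C] by blast
    from W(1) have "W \<in> out ` {0..<card T}" using bij_betw_imp_surj_on[OF out] by simp
    then obtain x where x: "x < card T" "equal_up_to_phase (out x) C" using W(2) by auto
    have fs: "final_state a U V0 [] = V0 * init_state (2^(n+a))"
      using unitary_carrier[OF U] by (simp add: final_state_def power_add)
    have "(1/2)^(n+a) = (cmod (final_state a U V0 [] $$ (x,0)))\<^sup>2"
      unfolding fs unfolding V0_def using uniform_state[of x "n+a"] x(1) card by simp
    also have "\<dots> \<le> success_prob n a V0 [] out U C"
      unfolding success_prob_def
      using member_le_sum[of x "{..<2^(n+a)}" "\<lambda>x. if equal_up_to_phase (out x) C then (cmod (final_state a U V0 [] $$ (x,0)))\<^sup>2 else 0"]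
        x card by simp
    finally show ?thesis .
  qed
  moreover have "valid_algorithm n a V0 []"
    using unitary_mpow[OF hadamard_unitary] by (simp add: valid_algorithm_def V0_def)
  moreover have "(0::real) < (1/2)^(n+a)" by simp
  ultimately show ?thesis by blast
qed

section \<open>Arithmetic of the query bound\<close>

lemma copies_suffice:
  fixes \<delta> :: real
  assumes n: "n \<ge> 1" and d: "0 < \<delta>" "\<delta> < 1"
  defines "\<beta> \<equiv> ln (1000/998) :: real"
  shows "\<exists>m\<ge>1. 16^n * (998/1000)^m + (11/16)^m \<le> \<delta>
    \<and> real (3 * m) \<le> 3 * ((ln 16 + ln 2 + 1) / \<beta> + 1) * (real n + ln (1/\<delta>))"
proof -
  define L where "L = ln (1/\<delta>)"
  have L: "L > 0" unfolding L_def using d by simp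
  have b: "\<beta> > 0" unfolding \<beta>_def by simp
  \<comment> \<open>The real solution of \<open>16^n * exp (- (\<beta> * t)) = \<delta> / 2\<close>;
    the other half of \<delta> covers the vote, whose base 11/16 is smaller.\<close>
  define t where "t = (real n * ln 16 + ln 2 + L) / \<beta>"
  have t: "t > 0" unfolding t_def using b L by (intro divide_pos_pos add_nonneg_pos) auto
  define m where "m = nat \<lceil>t\<rceil>"
  have m: "t \<le> real m" "real m \<le> t + 1" "m \<ge> 1" unfolding m_def using t by linarith+
  have "(998/1000)^m = exp (- (\<beta> * real m))"
  proof -
    have "(998/1000 :: real) = exp (- \<beta>)" unfolding \<beta>_def exp_minus by simp
    then show ?thesis by (simp only: exp_of_nat_mult[symmetric]) (simp add: mult.commute)
  qed
  also have "\<dots> \<le> exp (- (real n * ln 16 + ln 2 + L))"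
    using m(1) b by (simp add: t_def field_simps)
  also have "\<dots> = \<delta> / 2 / 16^n"
  proof -
    have "exp (real n * ln 16 + ln 2 + L) = 16^n * 2 * (1/\<delta>)"
      unfolding exp_add L_def exp_of_nat_mult using d by simp
    then show ?thesis unfolding exp_minus using d by (simp add: field_simps)
  qed
  finally have r: "16^n * (998/1000)^m \<le> \<delta> / 2" by (simp add: field_simps)
  have "(11/16)^m \<le> (998/1000 :: real)^m" by (rule power_mono) auto
  also have "\<dots> \<le> 16^n * (998/1000)^m" by simp
  also note r
  finally have "16^n * (998/1000)^m + (11/16)^m \<le> \<delta>" using r by simp
  moreover have "real (3 * m) \<le> 3 * ((ln 16 + ln 2 + 1) / \<beta> + 1) * (real n + L)"
  proof -
    have "real n * ln 16 + ln 2 + L \<le> (ln 16 + ln 2 + 1) * (real n + L)"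
    proof -
      have "0 \<le> ln (16::real) * L" "0 \<le> ln (2::real) * L" using L by simp_all
      moreover have "ln (2::real) \<le> real n * ln 2" using n by simp
      moreover have "(ln 16 + ln 2 + 1) * (real n + L)
        = real n * ln 16 + real n * ln 2 + real n + ln 16 * L + ln 2 * L + L" by (simp add: algebra_simps)
      ultimately show ?thesis by linarith
    qed
    then have "t \<le> (ln 16 + ln 2 + 1) / \<beta> * (real n + L)"
      unfolding t_def using b by (simp add: divide_right_mono)
    moreover have "1 \<le> real n + L" using n L by simp
    ultimately have "real (3 * m) \<le> 3 * ((ln 16 + ln 2 + 1) / \<beta> * (real n + L) + (real n + L))"
      using m(2) by simp
    also have "\<dots> = 3 * ((ln 16 + ln 2 + 1) / \<beta> + 1) * (real n + L)" by (simp only: distrib_right mult_1_left mult.assoc)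
    finally show ?thesis .
  qed
  ultimately show ?thesis using m(3) unfolding L_def by blast
qed

text \<open>The learner's count is of order \<open>n + ln (1/\<delta>)\<close>, which a constant
  times \<open>n * ln (n/\<delta>)\<close> dominates except near \<open>n = 1\<close>, \<delta> = 1,
  where the latter tends to 0. Guessing covers that corner.\<close>

theorem theorem2:
  shows "\<exists>K::real. K > 0 \<and>
    (\<forall>(n::nat) (\<epsilon>::real) (\<delta>::real).
       1 \<le> n \<longrightarrow> 0 \<le> \<epsilon> \<longrightarrow> \<epsilon> < sqrt 2 / 4 \<longrightarrow> 0 < \<delta> \<longrightarrow> \<delta> < 1 \<longrightarrow>
       (\<exists>(a::nat) V0 Vs (out::nat \<Rightarrow> complex mat).
          valid_algorithm n a V0 Vs \<and>
          real (length Vs) \<le> K * (real n * ln (real n / \<delta>)) / (sqrt 2 / 4 - \<epsilon>)\<^sup>2 \<and>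
          (\<forall>U C. unitary (2^n) U \<longrightarrow> C \<in> clifford n \<longrightarrow> Dist U C \<le> \<epsilon> \<longrightarrow>
                 success_prob n a V0 Vs out U C \<ge> 1 - \<delta>)))"
proof -
  obtain a1 V1 out1 p1 where g: "0 < p1" "valid_algorithm 1 a1 V1 []"
    "\<And>U C. unitary (2^1) U \<Longrightarrow> C \<in> clifford 1 \<Longrightarrow> success_prob 1 a1 V1 [] out1 U C \<ge> p1"
    using uniform_guess[of 1] by blast
  \<comment> \<open>Capped at 1/2 to keep \<open>1 - p0\<close> positive, so that \<open>l0\<close>
    makes sense.\<close>
  define p0 where "p0 = min p1 (1/2)"
  have p0: "0 < p0" "p0 \<le> 1/2" "p0 \<le> p1" using g(1) by (auto simp: p0_def)
  define l0 where "l0 = ln (1 / (1 - p0))"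
  have l0: "l0 > 0" unfolding l0_def using p0 by simp
  \<comment> \<open>For \<open>n \<ge> 2\<close>, \<open>ln 2\<close> pays for the summand
    \<open>n\<close> through \<open>ln n \<ge> ln 2\<close>. For \<open>n = 1\<close> one half of
    \<open>ln (1/\<delta>)\<close>, which is at least \<open>l0\<close>, pays for the summand 1 and
    the other half for the logarithm.\<close>
  define c where "c = min (ln 2) (min (1/2) (l0/2))"
  have c: "0 < c" "c \<le> ln 2" "c \<le> 1/2" "c \<le> l0/2" using l0 by (auto simp: c_def)
  define B where "B = 3 * ((ln 16 + ln 2 + 1) / ln (1000/998) + 1 :: real)"
  have B: "B > 0" unfolding B_def by (intro mult_pos_pos add_pos_pos divide_pos_pos) auto
  define K where "K = B / c"
  have K: "K > 0" unfolding K_def using B c by simp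
  have main: "\<exists>a V0 Vs out. valid_algorithm n a V0 Vs \<and>
          real (length Vs) \<le> K * (real n * ln (real n / \<delta>)) / (sqrt 2 / 4 - \<epsilon>)\<^sup>2 \<and>
          (\<forall>U C. unitary (2^n) U \<longrightarrow> C \<in> clifford n \<longrightarrow> Dist U C \<le> \<epsilon> \<longrightarrow>
                 success_prob n a V0 Vs out U C \<ge> 1 - \<delta>)"
    if n: "1 \<le> n" and e: "0 \<le> \<epsilon>" "\<epsilon> < sqrt 2 / 4" and d: "0 < \<delta>" "\<delta> < 1" for n :: nat and \<epsilon> \<delta> :: real
  \<comment> \<open>With \<delta> above \<open>1 - p0\<close>, success probability \<open>p0\<close>
    already exceeds \<open>1 - \<delta>\<close> and no query is made.\<close>
  proof (cases "n = 1 \<and> \<delta> > 1 - p0")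
    case True
    have "0 \<le> ln (1/\<delta>)" using d by simp
    then have "real (length ([] :: complex mat list)) \<le> K * (real n * ln (real n / \<delta>)) / (sqrt 2 / 4 - \<epsilon>)\<^sup>2"
      using True K by simp
    moreover have "success_prob n a1 V1 [] out1 U C \<ge> 1 - \<delta>" if "unitary (2^n) U" "C \<in> clifford n" for U C
      using g(3)[of U C] that True p0 by simp
    ultimately show ?thesis using g(2) True by blast
  next
    case False
    define L where "L = ln (1/\<delta>)"
    have L: "L > 0" unfolding L_def using d by simp
    have ln_split: "ln (real n / \<delta>) = ln (real n) + L" unfolding L_def using n d by (simp add: ln_div)
    have low: "c * (real n + L) \<le> real n * ln (real n / \<delta>)"
    proof (cases "n = 1")
      case True
      then have "1 / (1 - p0) \<le> 1 / \<delta>" using False d p0 by (intro divide_left_mono) auto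
      then have "l0 \<le> L" unfolding l0_def L_def using p0 by (intro ln_mono) auto
      moreover have "c * L \<le> 1/2 * L" using c L by (intro mult_right_mono) auto
      moreover have "real n * ln (real n / \<delta>) = L" using True by (simp add: L_def)
      moreover have "c * (real n + L) = c + c * L" using True by (simp add: algebra_simps)
      ultimately show ?thesis using c(4) by linarith
    next
      case False
      then have n2: "real n \<ge> 2" using n by simp
      have "c * real n \<le> ln 2 * real n" using c by (intro mult_right_mono) auto
      also have "\<dots> \<le> ln (real n) * real n" using n2 by (intro mult_right_mono ln_mono) auto
      finally have "c * real n \<le> real n * ln (real n)" by (simp add: mult.commute)
      moreover have "c * L \<le> real n * L" using c n2 L by (intro mult_right_mono) auto
      ultimately show ?thesis by (simp add: ln_split algebra_simps)
    qed
    obtain m where m: "m \<ge> 1" "16^n * (998/1000)^m + (11/16)^m \<le> \<delta>" "real (3 * m) \<le> B * (real n + L)"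
      using copies_suffice[OF n d] unfolding B_def L_def by blast
    obtain a V0 Vs out where alg: "valid_algorithm n a V0 Vs" "length Vs = 3 * m"
      "\<And>U C. unitary (2^n) U \<Longrightarrow> C \<in> clifford n \<Longrightarrow> Dist U C < sqrt 2 / 4 \<Longrightarrow>
       success_prob n a V0 Vs out U C \<ge> 1 - 16^n * (998/1000)^m - (11/16)^m"
      using learner[OF n m(1)] by blast
    let ?X = "real n * ln (real n / \<delta>)"
    have X: "0 \<le> ?X" using low c L by (intro order.trans[OF _ low]) auto
    have "real (length Vs) \<le> B * (real n + L)" using alg(2) m(3) by simp
    also have "\<dots> = K * (c * (real n + L))" unfolding K_def using c by simp
    also have "\<dots> \<le> K * ?X" using low K by (intro mult_left_mono) auto
    also have "\<dots> \<le> K * ?X / (sqrt 2 / 4 - \<epsilon>)\<^sup>2"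
    proof -
      have "sqrt 2 \<le> 4" by (intro real_le_lsqrt) auto
      then have "(sqrt 2 / 4 - \<epsilon>)\<^sup>2 \<le> 1" using e by (intro power_le_one) auto
      moreover have "0 < (sqrt 2 / 4 - \<epsilon>)\<^sup>2" using e by simp
      ultimately show ?thesis using K X by (simp add: le_divide_eq mult_left_le)
    qed
    finally have len: "real (length Vs) \<le> K * ?X / (sqrt 2 / 4 - \<epsilon>)\<^sup>2" .
    have "success_prob n a V0 Vs out U C \<ge> 1 - \<delta>"
      if "unitary (2^n) U" "C \<in> clifford n" "Dist U C \<le> \<epsilon>" for U C
      using alg(3)[OF that(1,2)] that(3) e m(2) by simp
    with alg(1) len show ?thesis by blast
  qed
  show ?thesis using K main by blast
qed

end
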